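(* Let $(X,f)$ be a minimal topological dynamical system with the approximate product property. Then $(X,f)$ must be uniquely ergodic and $h(f)=0$.
   Context: A topological dynamical system $(X,f)$ consists of a compact metric space $(X,d)$ and a continuous map $f:X\to X$; $h(f)$ is its topological entropy. $(X,f)$ is minimal if $X$ has no nonempty proper compact subset $\Lambda$ with $f(\Lambda)\subset\Lambda$. It is uniquely ergodic if it has exactly one invariant Borel probability measure. Approximate product property: for $n\in\mathbb{Z}^+$ and $\delta_1>0$, an increasing sequence $\{t_k\}_{k\in\mathbb{Z}^+}$ of nonnegative integers is $(n,\delta_1)$-spaced if $t_1=0$ and $n\le t_{k+1}-t_k<n(1+\delta_1)$ for every $k$. A sequence $\{x_k\}_{k\in\mathbb{Z}^+}$ in $X$ is $(n,\delta_1,\delta_2,\{t_k\},\varepsilon)$-traced by $z\in X$ if $\{t_k\}$ is $(n,\delta_1)$-spaced and $|\{j\in\{0,\dots,n-1\}: d(f^{t_k+j}(z),f^j(x_k))>\varepsilon\}|<\delta_2 n$ for every $k$. $(X,f)$ has the approximate product property if for every $\delta_1,\delta_2,\varepsilon>0$ there is $M>0$ such that for every $n>M$ and every sequence $\mathscr{C}$ in $X$ there are an $(n,\delta_1)$-spaced sequence $\mathscr{G}$ and $z\in X$ such that $\mathscr{C}$ is $(n,\delta_1,\delta_2,\mathscr{G},\varepsilon)$-traced by $z$. *)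

theory Defs
  imports "HOL-Probability.Probability"
begin

text \<open>A compact metric space is modelled as a nonempty compact subset \<open>X\<close> of a type of class
  \<open>metric_space\<close>.  The values of \<open>f\<close> outside \<open>X\<close> are irrelevant.\<close>

definition tds :: "'a::metric_space set \<Rightarrow> ('a \<Rightarrow> 'a) \<Rightarrow> bool" where
  "tds X f \<longleftrightarrow> X \<noteq> {} \<and> compact X \<and> continuous_on X f \<and> f ` X \<subseteq> X"

definition minimal_tds :: "'a::metric_space set \<Rightarrow> ('a \<Rightarrow> 'a) \<Rightarrow> bool" where
  "minimal_tds X f \<longleftrightarrow>
     tds X f \<and> \<not> (\<exists>\<Lambda>. \<Lambda> \<noteq> {} \<and> \<Lambda> \<subset> X \<and> compact \<Lambda> \<and> f ` \<Lambda> \<subseteq> \<Lambda>)"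

definition invariant_prob_measure ::
    "'a::metric_space set \<Rightarrow> ('a \<Rightarrow> 'a) \<Rightarrow> 'a measure \<Rightarrow> bool" where
  "invariant_prob_measure X f M \<longleftrightarrow>
     prob_space M \<and> space M = X \<and> sets M = sets (restrict_space borel X) \<and>
     (\<forall>A\<in>sets M. emeasure M (f -` A \<inter> X) = emeasure M A)"

definition uniquely_ergodic :: "'a::metric_space set \<Rightarrow> ('a \<Rightarrow> 'a) \<Rightarrow> bool" where
  "uniquely_ergodic X f \<longleftrightarrow> (\<exists>!M. invariant_prob_measure X f M)"

text \<open>Topological entropy is defined by Bowen's \<open>(n, \<epsilon>)\<close>-separated sets.\<close>

definition separated :: "('a::metric_space \<Rightarrow> 'a) \<Rightarrow> nat \<Rightarrow> real \<Rightarrow> 'a set \<Rightarrow> bool" where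
  "separated f n \<epsilon> E \<longleftrightarrow>
     (\<forall>x\<in>E. \<forall>y\<in>E. x \<noteq> y \<longrightarrow> (\<exists>k<n. dist ((f ^^ k) x) ((f ^^ k) y) > \<epsilon>))"

text \<open>The maximum exists by the lemma \<open>separated_card_finite\<close> below; finiteness of \<open>E\<close> is
  required because \<open>card\<close> is 0 on infinite sets.\<close>

definition max_separated ::
    "'a::metric_space set \<Rightarrow> ('a \<Rightarrow> 'a) \<Rightarrow> nat \<Rightarrow> real \<Rightarrow> nat" where
  "max_separated X f n \<epsilon> = Max {card E |E. finite E \<and> E \<subseteq> X \<and> separated f n \<epsilon> E}"

definition entropy_at_scale ::
    "'a::metric_space set \<Rightarrow> ('a \<Rightarrow> 'a) \<Rightarrow> real \<Rightarrow> ereal" where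
  "entropy_at_scale X f \<epsilon> = limsup (\<lambda>n. ereal (ln (real (max_separated X f n \<epsilon>)) / real n))"

definition top_entropy :: "'a::metric_space set \<Rightarrow> ('a \<Rightarrow> 'a) \<Rightarrow> ereal" where
  "top_entropy X f = Lim (at_right 0) (entropy_at_scale X f)"

text \<open>Sequences indexed by the positive integers are reindexed to start at 0.\<close>

definition spaced :: "nat \<Rightarrow> real \<Rightarrow> (nat \<Rightarrow> nat) \<Rightarrow> bool" where
  "spaced n \<delta>\<^sub>1 t \<longleftrightarrow> strict_mono t \<and> t 0 = 0 \<and>
     (\<forall>k. n \<le> t (Suc k) - t k \<and> real (t (Suc k) - t k) < real n * (1 + \<delta>\<^sub>1))"

definition traced ::
    "('a::metric_space \<Rightarrow> 'a) \<Rightarrow> nat \<Rightarrow> real \<Rightarrow> real \<Rightarrow> (nat \<Rightarrow> nat) \<Rightarrow> real \<Rightarrow> (nat \<Rightarrow> 'a) \<Rightarrow> 'a \<Rightarrow> bool"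
  where
  "traced f n \<delta>\<^sub>1 \<delta>\<^sub>2 t \<epsilon> x z \<longleftrightarrow> spaced n \<delta>\<^sub>1 t \<and>
     (\<forall>k. real (card {j\<in>{..<n}. dist ((f ^^ (t k + j)) z) ((f ^^ j) (x k)) > \<epsilon>}) < \<delta>\<^sub>2 * real n)"

definition approximate_product_property :: "'a::metric_space set \<Rightarrow> ('a \<Rightarrow> 'a) \<Rightarrow> bool" where
  "approximate_product_property X f \<longleftrightarrow>
     (\<forall>\<delta>\<^sub>1>0. \<forall>\<delta>\<^sub>2>0. \<forall>\<epsilon>>0. \<exists>M::real. M > 0 \<and>
        (\<forall>n::nat. real n > M \<longrightarrow>
          (\<forall>x. range x \<subseteq> X \<longrightarrow>
            (\<exists>t. spaced n \<delta>\<^sub>1 t \<and> (\<exists>z\<in>X. traced f n \<delta>\<^sub>1 \<delta>\<^sub>2 t \<epsilon> x z)))))"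

text \<open>Well-definedness of the entropy: the maxima and the limit as \<open>\<epsilon> \<rightarrow> 0\<close> exist.\<close>

lemma funpow_continuous_on:
  assumes "tds X f"
  shows "continuous_on X (f ^^ k) \<and> (f ^^ k) ` X \<subseteq> X"
proof (induction k)
  case 0
  then show ?case by (simp add: id_def)
next
  case (Suc k)
  have "continuous_on ((f ^^ k) ` X) f"
    using assms Suc continuous_on_subset unfolding tds_def by blast
  then have "continuous_on X (f \<circ> (f ^^ k))"
    using Suc continuous_on_compose by blast
  then show ?case using Suc assms unfolding tds_def by (auto simp: o_def)
qed

lemma separated_card_finite:
  assumes "tds X f" "\<epsilon> > 0"
  shows "finite {card E |E. finite E \<and> E \<subseteq> X \<and> separated f n \<epsilon> E}"
proof -
  have comp: "compact X" using assms(1) by (simp add: tds_def)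
  have "\<exists>d>0. \<forall>x\<in>X. \<forall>y\<in>X. dist x y < d \<longrightarrow> (\<forall>k<n. dist ((f ^^ k) x) ((f ^^ k) y) < \<epsilon>)"
  proof (induction n)
    case 0
    show ?case by (rule exI[of _ 1]) simp
  next
    case (Suc n)
    then obtain d where d: "d > 0"
      "\<And>x y k. x \<in> X \<Longrightarrow> y \<in> X \<Longrightarrow> dist x y < d \<Longrightarrow> k < n \<Longrightarrow> dist ((f ^^ k) x) ((f ^^ k) y) < \<epsilon>"
      by blast
    have "uniformly_continuous_on X (f ^^ n)"
      using compact_uniformly_continuous comp funpow_continuous_on[OF assms(1)] by blast
    then obtain e where e: "e > 0"
      "\<And>x y. x \<in> X \<Longrightarrow> y \<in> X \<Longrightarrow> dist x y < e \<Longrightarrow> dist ((f ^^ n) x) ((f ^^ n) y) < \<epsilon>"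
      unfolding uniformly_continuous_on_def using assms(2) by (meson dist_commute_lessI)
    show ?case
      by (rule exI[of _ "min d e"]) (use d e in \<open>auto simp: less_Suc_eq\<close>)
  qed
  then obtain d where d: "d > 0"
    "\<And>x y k. x \<in> X \<Longrightarrow> y \<in> X \<Longrightarrow> dist x y < d \<Longrightarrow> k < n \<Longrightarrow> dist ((f ^^ k) x) ((f ^^ k) y) < \<epsilon>"
    by blast
  obtain C where C: "finite C" "C \<subseteq> X" "X \<subseteq> (\<Union>c\<in>C. ball c (d/2))"
  proof (rule compactE_image[OF comp])
    show "X \<subseteq> (\<Union>c\<in>X. ball c (d/2))" using d(1) by auto
  qed auto
  have "card E \<le> card C" if E: "finite E" "E \<subseteq> X" "separated f n \<epsilon> E" for E
  proof -
    have "\<forall>x\<in>E. \<exists>c\<in>C. dist c x < d/2" using C(3) E(2) by fastforce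
    then obtain g where g: "\<And>x. x \<in> E \<Longrightarrow> g x \<in> C \<and> dist (g x) x < d/2" by metis
    have "inj_on g E"
    proof (rule inj_onI, rule ccontr)
      fix x y assume xy: "x \<in> E" "y \<in> E" "g x = g y" "x \<noteq> y"
      have "dist x y < d"
        using g[OF xy(1)] g[OF xy(2)] xy(3) dist_triangle3[of x y "g x"] by simp
      moreover obtain k where "k < n" "dist ((f ^^ k) x) ((f ^^ k) y) > \<epsilon>"
        using E(3) xy unfolding separated_def by blast
      moreover have "x \<in> X" "y \<in> X" using E(2) xy by auto
      ultimately show False using d(2)[of x y k] by simp
    qed
    then show ?thesis using g C(1) by (intro card_inj_on_le[of g]) auto
  qed
  then show ?thesis by (auto intro!: finite_subset[OF _ finite_atMost[of "card C"]])
qed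

lemma max_separated_antimono:
  assumes "tds X f" "0 < \<epsilon>" "\<epsilon> \<le> \<epsilon>'"
  shows "max_separated X f n \<epsilon>' \<le> max_separated X f n \<epsilon>"
  unfolding max_separated_def
proof (rule Max_mono)
  show "{card E |E. finite E \<and> E \<subseteq> X \<and> separated f n \<epsilon>' E}
      \<subseteq> {card E |E. finite E \<and> E \<subseteq> X \<and> separated f n \<epsilon> E}"
  proof -
    have "separated f n \<epsilon> E" if "separated f n \<epsilon>' E" for E
      using that assms(3) unfolding separated_def by (meson le_less_trans)
    then show ?thesis by blast
  qed
  show "{card E |E. finite E \<and> E \<subseteq> X \<and> separated f n \<epsilon>' E} \<noteq> {}"
  proof -
    have "card {} \<in> {card E |E. finite E \<and> E \<subseteq> X \<and> separated f n \<epsilon>' E}"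
      by (intro CollectI exI[of _ "{}"]) (simp add: separated_def)
    then show ?thesis by blast
  qed
qed (use assms separated_card_finite in blast)

lemma max_separated_pos:
  assumes "tds X f" "0 < \<epsilon>"
  shows "max_separated X f n \<epsilon> \<ge> 1"
proof -
  obtain x where "x \<in> X" using assms by (auto simp: tds_def)
  then have "1 \<in> {card E |E. finite E \<and> E \<subseteq> X \<and> separated f n \<epsilon> E}"
    by (intro CollectI exI[of _ "{x}"]) (simp add: separated_def)
  then show ?thesis unfolding max_separated_def using separated_card_finite[OF assms] by simp
qed

lemma top_entropy_tendsto:
  assumes "tds X f"
  shows "(entropy_at_scale X f \<longlongrightarrow> (SUP \<epsilon>\<in>{0<..}. entropy_at_scale X f \<epsilon>)) (at_right 0)"
    (is "(_ \<longlongrightarrow> ?S) _")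
proof (rule order_tendstoI)
  have anti: "entropy_at_scale X f \<epsilon>' \<le> entropy_at_scale X f \<epsilon>" if "0 < \<epsilon>" "\<epsilon> \<le> \<epsilon>'" for \<epsilon> \<epsilon>'
    unfolding entropy_at_scale_def
  proof (intro Limsup_mono always_eventually allI)
    fix n
    have "real (max_separated X f n \<epsilon>') \<le> real (max_separated X f n \<epsilon>)"
      using max_separated_antimono[OF assms that] by simp
    moreover have "real (max_separated X f n \<epsilon>') \<ge> 1"
      using max_separated_pos[OF assms, of \<epsilon>' n] that by linarith
    ultimately show "ereal (ln (real (max_separated X f n \<epsilon>')) / real n)
        \<le> ereal (ln (real (max_separated X f n \<epsilon>)) / real n)"
      by (simp add: divide_right_mono)
  qed
  fix a assume "a < ?S"
  then obtain e where e: "e > 0" "a < entropy_at_scale X f e" by (auto simp: less_SUP_iff)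
  show "eventually (\<lambda>\<epsilon>. a < entropy_at_scale X f \<epsilon>) (at_right 0)"
    unfolding eventually_at_right_field
    by (rule exI[of _ e]) (use e anti in \<open>auto intro: less_le_trans\<close>)
next
  fix a assume a: "?S < a"
  show "eventually (\<lambda>\<epsilon>. entropy_at_scale X f \<epsilon> < a) (at_right 0)"
    unfolding eventually_at_right_field
    by (rule exI[of _ 1]) (use a in \<open>auto intro: le_less_trans[OF SUP_upper]\<close>)
qed

lemma top_entropy_eq_SUP:
  assumes "tds X f"
  shows "top_entropy X f = (SUP \<epsilon>\<in>{0<..}. entropy_at_scale X f \<epsilon>)"
  unfolding top_entropy_def
  by (rule tendsto_Lim[OF _ top_entropy_tendsto[OF assms]]) simp

end

theory Submission
  imports Defs
begin

text \<open>Trace the constant sequence \<open>x, x, \<dots>\<close> by a point \<open>z\<close>. Every \<open>y\<close> is a limit of points of the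
  orbit of \<open>z\<close>, so each orbit segment of length \<open>n\<close> follows, up to a small proportion of errors,
  the end and then the beginning of the segment \<open>x, f x, \<dots>\<close> of about that length. Hence Birkhoff
  averages converge uniformly to constants; this limit functional is represented by the only
  invariant measure. Moreover a segment is determined, up to a small distance, by two numbers
  below \<open>2n\<close>, the few positions of the errors and the approximate values there, so that the
  number of separated segments grows subexponentially.\<close>

subsection \<open>Orbit segments\<close>

text \<open>Tracing controls the single point \<open>z\<close> and says nothing about other orbits;
  minimality is what transports the pattern to every \<open>y\<close>. The two conclusions then use
  the same comparison differently. For averages the order of the points is irrelevant: it is enough
  that the matching of indices is injective, so that most terms of the two sums can be paired. For
  entropy the order matters, but recording it costs a factor quadratic in \<open>n\<close>, which is
  invisible at exponential scale; what remains is the count of sparse fault patterns, made small by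
  letting the proportion of faults depend on the size of the net of approximate values. Existence of
  an invariant measure is obtained without compactness of the space of measures: the limit
  functional is invariant because the limit does not depend on the starting point, and the measure
  is built from it by Caratheodory's method.\<close>

lemma minimal_tds_tds: "minimal_tds X f \<Longrightarrow> tds X f"
  by (simp add: minimal_tds_def)

lemma funpow_in:
  assumes "tds X f" "x \<in> X"
  shows "(f ^^ k) x \<in> X"
  using funpow_continuous_on[OF assms(1), of k] assms(2) by blast

lemma orbit_close:
  assumes "tds X f" "y \<in> X" "\<epsilon> > 0"
  shows "\<exists>d>0. \<forall>w\<in>X. dist w y < d \<longrightarrow> (\<forall>i<n. dist ((f ^^ i) w) ((f ^^ i) y) < \<epsilon>)"
proof (induction n)
  case 0
  show ?case by (rule exI[of _ 1]) simp
next
  case (Suc n)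
  then obtain d where d: "d > 0"
    "\<And>w i. w \<in> X \<Longrightarrow> dist w y < d \<Longrightarrow> i < n \<Longrightarrow> dist ((f ^^ i) w) ((f ^^ i) y) < \<epsilon>"
    by blast
  obtain e where e: "e > 0"
    "\<And>w. w \<in> X \<Longrightarrow> dist w y < e \<Longrightarrow> dist ((f ^^ n) w) ((f ^^ n) y) < \<epsilon>"
    using funpow_continuous_on[OF assms(1), of n] assms(2,3) unfolding continuous_on_iff by metis
  show ?case
    by (rule exI[of _ "min d e"]) (use d e in \<open>auto simp: less_Suc_eq\<close>)
qed

lemma minimal_orbit_dense:
  assumes "minimal_tds X f" "z \<in> X"
  shows "closure (range (\<lambda>m. (f ^^ m) z)) = X"
proof -
  let ?O = "range (\<lambda>m. (f ^^ m) z)"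
  have tds: "tds X f" by (rule minimal_tds_tds[OF assms(1)])
  then have X: "compact X" "continuous_on X f" by (auto simp: tds_def)
  have OX: "?O \<subseteq> X" using funpow_in[OF tds assms(2)] by blast
  have sub: "closure ?O \<subseteq> X"
    using OX X(1) by (intro closure_minimal compact_imp_closed)
  have "f ` closure ?O \<subseteq> closure ?O"
  proof (rule image_closure_subset)
    show "continuous_on (closure ?O) f" using X(2) sub by (rule continuous_on_subset)
    have "f ` ?O \<subseteq> ?O" by (auto intro: range_eqI[of _ _ "Suc _"])
    then show "f ` ?O \<subseteq> closure ?O" using closure_subset by blast
  qed simp
  moreover have "compact (closure ?O)"
    using compact_Int_closed[OF X(1) closed_closure[of ?O]] sub by (simp add: Int_absorb1)
  moreover have "closure ?O \<noteq> {}" by auto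
  ultimately show ?thesis using assms(1) sub unfolding minimal_tds_def by blast
qed

text \<open>Nothing bounds the time \<open>m\<close> or relates it to the block structure, so the
  window may start anywhere inside a block of the tracing orbit.\<close>

lemma minimal_orbit_shadows:
  assumes "minimal_tds X f" "z \<in> X" "y \<in> X" "\<epsilon> > 0"
  shows "\<exists>m. \<forall>i<n. dist ((f ^^ (m + i)) z) ((f ^^ i) y) < \<epsilon>"
proof -
  have tds: "tds X f" by (rule minimal_tds_tds[OF assms(1)])
  obtain d where d: "d > 0"
    "\<And>w i. w \<in> X \<Longrightarrow> dist w y < d \<Longrightarrow> i < n \<Longrightarrow> dist ((f ^^ i) w) ((f ^^ i) y) < \<epsilon>"
    using orbit_close[OF tds assms(3,4)] by metis
  have "y \<in> closure (range (\<lambda>m. (f ^^ m) z))"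
    using minimal_orbit_dense[OF assms(1,2)] assms(3) by simp
  then obtain m where "dist ((f ^^ m) z) y < d"
    using d(1) unfolding closure_approachable by blast
  then have "dist ((f ^^ (m + i)) z) ((f ^^ i) y) < \<epsilon>" if "i < n" for i
    using d(2)[OF funpow_in[OF tds assms(2)], of m i] that
    by (simp add: funpow_add add.commute[of m i])
  then show ?thesis by blast
qed

text \<open>A window of length \<open>n\<close> of the tracing orbit meets at most two consecutive blocks, of which the
  first has length \<open>g\<close> and is entered at position \<open>u\<close>. The \<open>i\<close>-th point of the window is compared
  with the point of index \<open>phase u g i\<close> of the traced segment; indices \<open>\<ge> n\<close> fall in the gap
  between the blocks and count as faults.\<close>

definition phase :: "nat \<Rightarrow> nat \<Rightarrow> nat \<Rightarrow> nat" where
  "phase u g i = (if u + i < g then u + i else u + i - g)"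

definition faults :: "('a::metric_space \<Rightarrow> 'a) \<Rightarrow> real \<Rightarrow> nat \<Rightarrow> 'a \<Rightarrow> nat \<Rightarrow> nat \<Rightarrow> 'a \<Rightarrow> nat set" where
  "faults f \<epsilon> n x u g y =
     {i \<in> {..<n}. \<not> (phase u g i < n \<and> dist ((f ^^ i) y) ((f ^^ phase u g i) x) \<le> \<epsilon>)}"

text \<open>Indices coming from the first block are at least \<open>u\<close>; those from the second
  are below \<open>u + n - g\<close>, hence below \<open>u\<close> because
  \<open>n \<le> g\<close>.\<close>

lemma inj_on_phase:
  assumes "n \<le> g" "u < g"
  shows "inj_on (phase u g) {..<n}"
  using assms by (auto simp: inj_on_def phase_def split: if_splits)

lemma strict_mono_interval:
  fixes t :: "nat \<Rightarrow> nat"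
  assumes "strict_mono t" "t 0 = 0"
  shows "\<exists>k. t k \<le> m \<and> m < t (Suc k)"
proof (induction m)
  case 0
  show ?case using assms by (metis less_Suc_eq_0_disj order_refl strict_mono_less)
next
  case (Suc m)
  then obtain k where k: "t k \<le> m" "m < t (Suc k)" by blast
  show ?case
  proof (cases "Suc m < t (Suc k)")
    case True then show ?thesis using k by (auto intro: le_SucI)
  next
    case False
    then have "Suc m = t (Suc k)" using k by simp
    then show ?thesis using assms(1) by (metis lessI order_refl strict_mono_less)
  qed
qed

lemma minimal_approximate_product_faults:
  fixes X :: "'a::metric_space set"
  assumes min: "minimal_tds X f" and app: "approximate_product_property X f"
    and "\<delta> > 0" "\<epsilon> > 0"
  shows "\<exists>M. \<forall>n>M. \<forall>x\<in>X. \<forall>y\<in>X. \<exists>u g. u < g \<and> n \<le> g \<and> g < 2 * n \<and>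
           real (card (faults f \<epsilon> n x u g y)) \<le> \<delta> * real n"
proof -
  \<comment> \<open>One third each for the gap after the first block and for the tracing errors of
    the two blocks; the cap 1 gives \<open>g < 2 * n\<close>.\<close>
  define \<delta>' where "\<delta>' = min 1 (\<delta> / 3)"
  have \<delta>': "\<delta>' > 0" "\<delta>' \<le> 1" "3 * \<delta>' \<le> \<delta>" using assms(3) by (auto simp: \<delta>'_def)
  obtain M :: real where M: "M > 0" "\<And>n x. real n > M \<Longrightarrow> range x \<subseteq> X \<Longrightarrow>
      \<exists>t. spaced n \<delta>' t \<and> (\<exists>z\<in>X. traced f n \<delta>' \<delta>' t (\<epsilon>/2) x z)"
    using app \<delta>'(1) assms(4) unfolding approximate_product_property_def by (metis half_gt_zero)
  have "\<exists>u g. u < g \<and> n \<le> g \<and> g < 2 * n \<and> real (card (faults f \<epsilon> n x u g y)) \<le> \<delta> * real n"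
    if n: "n > nat \<lceil>M\<rceil>" and xy: "x \<in> X" "y \<in> X" for n x y
  proof -
    have nM: "real n > M" using n by linarith
    obtain t z where t: "spaced n \<delta>' t" and z: "z \<in> X" "traced f n \<delta>' \<delta>' t (\<epsilon>/2) (\<lambda>_. x) z"
      using M(2)[OF nM, of "\<lambda>_. x"] xy by auto
    obtain m where m: "\<And>i. i < n \<Longrightarrow> dist ((f ^^ (m + i)) z) ((f ^^ i) y) < \<epsilon>/2"
      using minimal_orbit_shadows[OF min z(1) xy(2)] assms(4) by (metis half_gt_zero)
    obtain k where k: "t k \<le> m" "m < t (Suc k)"
      using strict_mono_interval[of t m] t by (auto simp: spaced_def)
    define u g where "u = m - t k" and "g = t (Suc k) - t k"
    have ug: "u < g" "n \<le> g" "real g < real n * (1 + \<delta>')"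
      using k t unfolding u_def g_def spaced_def by (linarith, blast+)
    have "real g < real (2 * n)"
    proof -
      have "real n * (1 + \<delta>') \<le> real n * 2" using \<delta>'(2) by (intro mult_left_mono) auto
      then show ?thesis using ug(3) by simp
    qed
    then have g2: "g < 2 * n" by linarith
    define bad where "bad l = {j\<in>{..<n}. dist ((f ^^ (t l + j)) z) ((f ^^ j) x) > \<epsilon>/2}" for l
    have bad: "finite (bad l)" "real (card (bad l)) < \<delta>' * real n" for l
      using z(2) by (auto simp: bad_def traced_def)
    have dist: "dist ((f ^^ i) y) ((f ^^ j) x) \<le> \<epsilon>"
      if "i < n" "j < n" "j \<notin> bad l" "t l + j = m + i" for i j l
      using m[OF that(1)] that dist_triangle3[of "(f ^^ i) y" "(f ^^ j) x" "(f ^^ (m + i)) z"]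
      by (simp add: bad_def)
    \<comment> \<open>In the first block a fault is a tracing error or lies in the gap. In the
      second block \<open>u < g\<close> keeps the index below \<open>n\<close>, so the window ends
      before the second gap and only tracing errors remain.\<close>
    have "phase u g ` faults f \<epsilon> n x u g y \<subseteq> {n..<g} \<union> bad k \<union> bad (Suc k)"
    proof
      fix j assume "j \<in> phase u g ` faults f \<epsilon> n x u g y"
      then obtain i where i: "j = phase u g i" "i < n"
        "\<not> (j < n \<and> dist ((f ^^ i) y) ((f ^^ j) x) \<le> \<epsilon>)"
        by (auto simp: faults_def)
      show "j \<in> {n..<g} \<union> bad k \<union> bad (Suc k)"
      proof (cases "u + i < g")
        case True
        then have j: "j = u + i" by (simp add: i phase_def)
        then have "t k + j = m + i" using k by (simp add: u_def)
        moreover have "j \<in> {n..<g}" if "\<not> j < n" using that j True by simp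
        ultimately show ?thesis using dist[of i j k] i(2,3) by blast
      next
        case False
        then have "j = u + i - g" by (simp add: i phase_def)
        moreover have "j < n" using calculation ug i(2) by linarith
        moreover have "t (Suc k) + j = m + i"
          using calculation(1) False k by (auto simp: u_def g_def)
        ultimately show ?thesis using dist[of i j "Suc k"] i(2,3) by blast
      qed
    qed
    then have "card (phase u g ` faults f \<epsilon> n x u g y) \<le> card ({n..<g} \<union> bad k \<union> bad (Suc k))"
      by (intro card_mono) (auto simp: bad)
    also have "\<dots> \<le> (g - n) + card (bad k) + card (bad (Suc k))"
      by (metis (no_types, lifting) add_le_mono1 card_Un_le card_atLeastLessThan le_trans)
    also have "card (phase u g ` faults f \<epsilon> n x u g y) = card (faults f \<epsilon> n x u g y)"
      using inj_on_phase[OF ug(2,1)]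
      by (intro card_image) (auto simp: faults_def intro: inj_on_subset)
    finally have "real (card (faults f \<epsilon> n x u g y))
        \<le> (real g - real n) + card (bad k) + card (bad (Suc k))"
      using ug(2) by linarith
    also have "\<dots> \<le> 3 * \<delta>' * real n"
      using bad(2)[of k] bad(2)[of "Suc k"] ug(3) by (simp add: algebra_simps)
    also have "\<dots> \<le> \<delta> * real n" using \<delta>'(3) by (intro mult_right_mono) auto
    finally show ?thesis using ug g2 by blast
  qed
  then show ?thesis by blast
qed

subsection \<open>Birkhoff averages\<close>

definition birkhoff_sum :: "('a \<Rightarrow> 'a) \<Rightarrow> ('a \<Rightarrow> real) \<Rightarrow> nat \<Rightarrow> 'a \<Rightarrow> real" where
  "birkhoff_sum f \<phi> n x = (\<Sum>i<n. \<phi> ((f ^^ i) x))"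

lemma birkhoff_sum_add:
  "birkhoff_sum f \<phi> (m + n) x = birkhoff_sum f \<phi> m x + birkhoff_sum f \<phi> n ((f ^^ m) x)"
proof -
  have "birkhoff_sum f \<phi> (m + n) x
      = (\<Sum>i<m. \<phi> ((f ^^ i) x)) + (\<Sum>i=m..<m+n. \<phi> ((f ^^ i) x))"
    unfolding birkhoff_sum_def
    by (metis le_add1 lessThan_atLeast0 sum.atLeastLessThan_concat zero_le)
  also have "(\<Sum>i=m..<m+n. \<phi> ((f ^^ i) x)) = (\<Sum>i<n. \<phi> ((f ^^ (i + m)) x))"
    using sum.shift_bounds_nat_ivl[of "\<lambda>i. \<phi> ((f ^^ i) x)" 0 m n]
    by (simp add: add.commute lessThan_atLeast0)
  finally show ?thesis by (simp add: birkhoff_sum_def funpow_add)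
qed

lemma birkhoff_sum_bound:
  assumes "tds X f" "\<And>x. x \<in> X \<Longrightarrow> \<bar>\<phi> x\<bar> \<le> B" "x \<in> X"
  shows "\<bar>birkhoff_sum f \<phi> n x\<bar> \<le> real n * B"
proof -
  have "\<bar>birkhoff_sum f \<phi> n x\<bar> \<le> (\<Sum>i<n. \<bar>\<phi> ((f ^^ i) x)\<bar>)"
    unfolding birkhoff_sum_def by (rule sum_abs)
  also have "\<dots> \<le> (\<Sum>i<n. B)"
    using assms funpow_in[OF assms(1,3)] by (intro sum_mono) auto
  finally show ?thesis by simp
qed

lemma compact_continuous_real_bound:
  fixes \<phi> :: "'a::metric_space \<Rightarrow> real"
  assumes "compact X" "continuous_on X \<phi>"
  obtains B where "B > 0" "\<And>x. x \<in> X \<Longrightarrow> \<bar>\<phi> x\<bar> \<le> B"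
  using compact_imp_bounded[OF compact_continuous_image[OF assms(2,1)]]
  by (metis bounded_pos imageI real_norm_def)

text \<open>Away from the faults, \<open>phase\<close> pairs terms of the two sums injectively, and
  paired terms differ little by uniform continuity. The unpaired terms, equally few on both sides,
  are bounded by the supremum of \<open>\<phi>\<close> in absolute value.\<close>

lemma birkhoff_sums_close:
  fixes X :: "'a::metric_space set"
  assumes min: "minimal_tds X f" and app: "approximate_product_property X f"
    and \<phi>: "continuous_on X \<phi>" and "\<eta> > 0"
  shows "\<exists>M. \<forall>n>M. \<forall>x\<in>X. \<forall>y\<in>X.
           \<bar>birkhoff_sum f \<phi> n y - birkhoff_sum f \<phi> n x\<bar> \<le> \<eta> * real n"
proof -
  have tds: "tds X f" by (rule minimal_tds_tds[OF min])
  then have X: "compact X" by (simp add: tds_def)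
  obtain B where B: "B > 0" "\<And>x. x \<in> X \<Longrightarrow> \<bar>\<phi> x\<bar> \<le> B"
    using compact_continuous_real_bound[OF X \<phi>] by blast
  obtain e where e: "e > 0" "\<And>x y. x \<in> X \<Longrightarrow> y \<in> X \<Longrightarrow> dist x y < e \<Longrightarrow> \<bar>\<phi> x - \<phi> y\<bar> < \<eta>/2"
    using compact_uniformly_continuous[OF \<phi> X] assms(4)
    unfolding uniformly_continuous_on_def dist_real_def by (metis dist_commute half_gt_zero)
  \<comment> \<open>The unpaired terms contribute at most \<open>2 * B * \<delta> * real n\<close>,
    which becomes half of the allowed error; the paired terms use the other half.\<close>
  define \<delta> where "\<delta> = \<eta> / (4 * B)"
  have \<delta>: "\<delta> > 0" "2 * B * \<delta> = \<eta> / 2" using B(1) assms(4) by (auto simp: \<delta>_def)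
  \<comment> \<open>The scale \<open>e/2\<close> turns the non-strict bound in \<open>faults\<close>
    into the strict one that uniform continuity requires.\<close>
  obtain M where M: "\<And>n x y. n > M \<Longrightarrow> x \<in> X \<Longrightarrow> y \<in> X \<Longrightarrow> \<exists>u g. u < g \<and> n \<le> g \<and> g < 2 * n \<and>
           real (card (faults f (e/2) n x u g y)) \<le> \<delta> * real n"
    using minimal_approximate_product_faults[OF min app \<delta>(1), of "e/2"] e(1) by (metis half_gt_zero)
  have "\<bar>birkhoff_sum f \<phi> n y - birkhoff_sum f \<phi> n x\<bar> \<le> \<eta> * real n"
    if n: "n > M" and xy: "x \<in> X" "y \<in> X" for n x y
  proof -
    obtain u g where ug: "u < g" "n \<le> g" "real (card (faults f (e/2) n x u g y)) \<le> \<delta> * real n"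
      using M[OF n xy] by blast
    let ?F = "faults f (e/2) n x u g y" and ?p = "phase u g"
    define G where "G = {..<n} - ?F"
    have G: "finite G" "G \<subseteq> {..<n}" "?F \<subseteq> {..<n}" "?p ` G \<subseteq> {..<n}"
      by (auto simp: G_def faults_def)
    have inj: "inj_on ?p G" using inj_on_phase[OF ug(2,1)] G(2) by (rule inj_on_subset)
    \<comment> \<open>The phase map is injective on \<open>G\<close> with values in
      \<open>{..<n}\<close>, so as many indices stay unpaired at \<open>x\<close> as there are
      faults at \<open>y\<close>.\<close>
    have cardF: "card ({..<n} - ?p ` G) = card ?F"
    proof -
      have "card G = n - card ?F" using G(3) by (simp add: G_def card_Diff_subset finite_subset)
      moreover have "card ?F \<le> n" using card_mono[OF _ G(3)] by simp
      ultimately show ?thesis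
        using G(1,4) card_image[OF inj] by (simp add: card_Diff_subset)
    qed
    have bnd: "\<bar>\<phi> ((f ^^ i) w)\<bar> \<le> B" if "w \<in> X" for i w
      using B(2) funpow_in[OF tds that] by blast
    have 1: "\<bar>\<Sum>i\<in>?F. \<phi> ((f ^^ i) y)\<bar> \<le> card ?F * B"
      using order_trans[OF sum_abs sum_bounded_above[of ?F "\<lambda>i. \<bar>\<phi> ((f ^^ i) y)\<bar>" B]] bnd xy by simp
    have 2: "\<bar>\<Sum>i\<in>{..<n} - ?p ` G. \<phi> ((f ^^ i) x)\<bar> \<le> card ?F * B"
      using order_trans[OF sum_abs sum_bounded_above[of "{..<n} - ?p ` G" "\<lambda>i. \<bar>\<phi> ((f ^^ i) x)\<bar>" B]]
        bnd xy by (simp add: cardF)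
    have 3: "\<bar>\<Sum>i\<in>G. \<phi> ((f ^^ i) y) - \<phi> ((f ^^ ?p i) x)\<bar> \<le> card G * (\<eta>/2)"
    proof (rule order_trans[OF sum_abs sum_bounded_above])
      fix i assume "i \<in> G"
      then have "dist ((f ^^ i) y) ((f ^^ ?p i) x) \<le> e/2" by (auto simp: G_def faults_def)
      then show "\<bar>\<phi> ((f ^^ i) y) - \<phi> ((f ^^ ?p i) x)\<bar> \<le> \<eta>/2"
        using e funpow_in[OF tds] xy by (intro less_imp_le e(2)) auto
    qed
    have "birkhoff_sum f \<phi> n y = (\<Sum>i\<in>G. \<phi> ((f ^^ i) y)) + (\<Sum>i\<in>?F. \<phi> ((f ^^ i) y))"
      unfolding birkhoff_sum_def G_def by (intro sum.subset_diff G) auto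
    moreover have "birkhoff_sum f \<phi> n x
        = (\<Sum>i\<in>{..<n} - ?p ` G. \<phi> ((f ^^ i) x)) + (\<Sum>i\<in>G. \<phi> ((f ^^ ?p i) x))"
      unfolding birkhoff_sum_def sum.subset_diff[OF G(4) finite_lessThan] sum.reindex[OF inj]
      by (simp add: o_def)
    ultimately have "\<bar>birkhoff_sum f \<phi> n y - birkhoff_sum f \<phi> n x\<bar>
        \<le> card G * (\<eta>/2) + 2 * (card ?F * B)"
      using 1 2 3 unfolding sum_subtractf by linarith
    also have "\<dots> \<le> real n * (\<eta>/2) + 2 * (\<delta> * real n * B)"
      using card_mono[OF _ G(2)] ug(3) B(1) assms(4)
      by (intro add_mono mult_mono mult_left_mono mult_right_mono) auto
    also have "\<dots> = real n * (\<eta>/2) + (2 * B * \<delta>) * real n" by simp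
    also have "\<dots> = \<eta> * real n" unfolding \<delta>(2) by simp
    finally show ?thesis .
  qed
  then show ?thesis by blast
qed

text \<open>Each block of length \<open>n\<close> that is split off costs
  \<open>\<eta> * real n\<close>; only the last, incomplete block pays
  \<open>2 * real n * B\<close>, so this term does not grow with \<open>N\<close>.\<close>

lemma birkhoff_sum_almost_linear:
  assumes tds: "tds X f" and B: "\<And>x. x \<in> X \<Longrightarrow> \<bar>\<phi> x\<bar> \<le> B" and n: "n > 0"
    and close: "\<And>x. x \<in> X \<Longrightarrow> \<bar>birkhoff_sum f \<phi> n x - real n * a\<bar> \<le> \<eta> * real n"
    and a: "\<bar>a\<bar> \<le> B" and "x \<in> X" "\<eta> > 0"
  shows "\<bar>birkhoff_sum f \<phi> N x - real N * a\<bar> \<le> \<eta> * real N + 2 * real n * B"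
  using \<open>x \<in> X\<close>
proof (induction N arbitrary: x rule: less_induct)
  case (less N)
  have "B \<ge> 0" using a by linarith
  show ?case
  proof (cases "N < n")
    case True
    have "\<bar>birkhoff_sum f \<phi> N x\<bar> \<le> real N * B" by (rule birkhoff_sum_bound[OF tds B less.prems])
    moreover have "\<bar>real N * a\<bar> \<le> real N * B" using a by (simp add: abs_mult mult_left_mono)
    moreover have "real N * B \<le> real n * B" using True \<open>B \<ge> 0\<close> by (simp add: mult_right_mono)
    moreover have "\<eta> * real N \<ge> 0" using assms(7) by simp
    ultimately show ?thesis by linarith
  next
    case False
    then obtain k where k: "N = n + k" by (metis le_add_diff_inverse not_less)
    have "\<bar>birkhoff_sum f \<phi> k ((f ^^ n) x) - real k * a\<bar> \<le> \<eta> * real k + 2 * real n * B"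
      using k n funpow_in[OF tds less.prems] by (intro less.IH) auto
    then show ?thesis
      using close[OF less.prems] unfolding k birkhoff_sum_add
      by (simp add: algebra_simps)
  qed
qed

text \<open>Closeness at one length compares points but not lengths. Almost linearity carries it
  from one length to all large ones, which makes the averages at a fixed point Cauchy and the
  convergence uniform.\<close>

lemma birkhoff_averages_uniform_limit:
  fixes X :: "'a::metric_space set"
  assumes min: "minimal_tds X f" and app: "approximate_product_property X f"
    and \<phi>: "continuous_on X \<phi>"
  shows "\<exists>c. uniform_limit X (\<lambda>n x. birkhoff_sum f \<phi> n x / real n) (\<lambda>_. c) sequentially"
proof -
  have tds: "tds X f" by (rule minimal_tds_tds[OF min])
  then have X: "compact X" by (simp add: tds_def)
  obtain x0 where x0: "x0 \<in> X" using tds by (auto simp: tds_def)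
  obtain B where B: "B > 0" "\<And>x. x \<in> X \<Longrightarrow> \<bar>\<phi> x\<bar> \<le> B"
    using compact_continuous_real_bound[OF X \<phi>] by blast
  let ?A = "\<lambda>n x. birkhoff_sum f \<phi> n x / real n"
  have near: "\<exists>a N0. \<forall>N\<ge>N0. \<forall>x\<in>X. \<bar>?A N x - a\<bar> < \<eta>" if \<eta>: "\<eta> > 0" for \<eta>
  proof -
    obtain M where M: "\<forall>n>M. \<forall>x\<in>X. \<forall>y\<in>X.
        \<bar>birkhoff_sum f \<phi> n y - birkhoff_sum f \<phi> n x\<bar> \<le> \<eta>/2 * real n"
      using birkhoff_sums_close[OF min app \<phi> half_gt_zero[OF \<eta>]] by blast
    define n where "n = Suc M"
    have n: "n > 0" "\<And>x y. x \<in> X \<Longrightarrow> y \<in> X \<Longrightarrow>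
        \<bar>birkhoff_sum f \<phi> n y - birkhoff_sum f \<phi> n x\<bar> \<le> \<eta>/2 * real n"
      using M unfolding n_def by blast+
    define a where "a = ?A n x0"
    have na: "real n * a = birkhoff_sum f \<phi> n x0" using n(1) by (simp add: a_def)
    have a: "\<bar>a\<bar> \<le> B"
      using birkhoff_sum_bound[OF tds B(2) x0, where n = n] n(1) by (simp add: a_def field_simps)
    \<comment> \<open>Beyond \<open>N0\<close> the boundary term \<open>2 * real n * B\<close> is
      less than \<open>\<eta>/2 * real N\<close>; the blocks use up the other half of
      \<open>\<eta>\<close>.\<close>
    obtain N0 where N0: "real N0 > 4 * real n * B / \<eta>" using reals_Archimedean2 by blast
    have "\<bar>?A N x - a\<bar> < \<eta>" if N: "N \<ge> Suc N0" and x: "x \<in> X" for N x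
    proof -
      have "\<bar>birkhoff_sum f \<phi> N x - real N * a\<bar> \<le> \<eta>/2 * real N + 2 * real n * B"
        using n(2)[OF x0] na a x \<open>\<eta> > 0\<close>
        by (intro birkhoff_sum_almost_linear[OF tds B(2) n(1)]) auto
      moreover have "4 * real n * B < \<eta> * real N"
      proof -
        have "4 * real n * B < \<eta> * real N0" using N0 \<open>\<eta> > 0\<close> by (simp add: field_simps)
        also have "\<dots> \<le> \<eta> * real N" using N \<open>\<eta> > 0\<close> by simp
        finally show ?thesis .
      qed
      ultimately have "\<bar>birkhoff_sum f \<phi> N x - real N * a\<bar> < \<eta> * real N" by linarith
      moreover have "?A N x - a = (birkhoff_sum f \<phi> N x - real N * a) / real N"
        using N by (simp add: field_simps)
      ultimately show ?thesis using N by (simp add: abs_divide field_simps)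
    qed
    then show ?thesis by blast
  qed
  have "Cauchy (\<lambda>n. ?A n x0)"
  proof (rule CauchyI)
    fix e :: real assume "e > 0"
    then obtain a N0 where "\<forall>N\<ge>N0. \<forall>x\<in>X. \<bar>?A N x - a\<bar> < e/2"
      using near[of "e/2"] by auto
    then have "\<forall>N\<ge>N0. \<bar>?A N x0 - a\<bar> < e/2" using x0 by blast
    then have "\<bar>?A m x0 - ?A n x0\<bar> < e" if "m \<ge> N0" "n \<ge> N0" for m n
      using that by (smt (verit) field_sum_of_halves)
    then show "\<exists>M. \<forall>m\<ge>M. \<forall>n\<ge>M. norm (?A m x0 - ?A n x0) < e" by auto
  qed
  then obtain c where c: "(\<lambda>n. ?A n x0) \<longlonglongrightarrow> c"
    using Cauchy_convergent convergent_def by blast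
  have "uniform_limit X ?A (\<lambda>_. c) sequentially"
  proof (rule uniform_limitI)
    fix e :: real assume "e > 0"
    then obtain a N0 where a: "\<And>N x. N \<ge> N0 \<Longrightarrow> x \<in> X \<Longrightarrow> \<bar>?A N x - a\<bar> < e/2"
      using near[of "e/2"] by auto
    have "\<bar>c - a\<bar> \<le> e/2"
    proof (rule LIMSEQ_le_const2)
      show "(\<lambda>n. \<bar>?A n x0 - a\<bar>) \<longlonglongrightarrow> \<bar>c - a\<bar>" by (intro tendsto_intros c)
      show "\<exists>N. \<forall>n\<ge>N. \<bar>?A n x0 - a\<bar> \<le> e/2" using a[OF _ x0] less_imp_le by blast
    qed
    then have "dist (?A n x) c < e" if "n \<ge> N0" "x \<in> X" for n x
      using a[OF that] unfolding dist_real_def by linarith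
    then show "\<forall>\<^sub>F n in sequentially. \<forall>x\<in>X. dist (?A n x) c < e"
      unfolding eventually_sequentially by blast
  qed
  then show ?thesis by blast
qed

subsection \<open>Invariant measures and continuous functions\<close>

text \<open>The distance to \<open>X - U\<close> serves, except when this set is empty: there
  \<open>infdist\<close> is 0 by convention, and a constant replaces it.\<close>

lemma open_eq_positive_continuous:
  fixes U :: "'a::metric_space set"
  assumes "closed X" "open U"
  obtains g :: "'a \<Rightarrow> real"
  where "continuous_on X g" "\<And>x. 0 \<le> g x" "\<And>x. x \<in> X \<Longrightarrow> 0 < g x \<longleftrightarrow> x \<in> U"
proof (cases "X \<subseteq> U")
  case True
  then show ?thesis by (intro that[of "\<lambda>_. 1"]) auto
next
  case False
  show ?thesis
  proof (rule that)
    show "continuous_on X (\<lambda>x. infdist x (X - U))" by (intro continuous_intros)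
    show "0 < infdist x (X - U) \<longleftrightarrow> x \<in> U" if "x \<in> X" for x
      using infdist_pos_not_in_closed[of "X - U" x] closed_Diff[OF assms] False that
      by (cases "x \<in> U") auto
  qed (rule infdist_nonneg)
qed

lemma open_indicator_approx:
  fixes U :: "'a::metric_space set"
  assumes "closed X" "open U"
  obtains \<phi> :: "nat \<Rightarrow> 'a \<Rightarrow> real"
  where "\<And>k. continuous_on X (\<phi> k)"
    and "\<And>k x. x \<in> X \<Longrightarrow> 0 \<le> \<phi> k x \<and> \<phi> k x \<le> indicator U x"
    and "\<And>x. mono (\<lambda>k. \<phi> k x)"
    and "\<And>x. x \<in> X \<Longrightarrow> (\<lambda>k. \<phi> k x) \<longlonglongrightarrow> indicator U x"
proof -
  obtain g :: "'a \<Rightarrow> real" where g: "continuous_on X g" "\<And>x. 0 \<le> g x"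
    "\<And>x. x \<in> X \<Longrightarrow> 0 < g x \<longleftrightarrow> x \<in> U"
    using open_eq_positive_continuous[OF assms] by blast
  define \<phi> where "\<phi> k x = min 1 (real k * g x)" for k x
  have gU: "g x = 0" if "x \<in> X" "x \<notin> U" for x using g(2)[of x] g(3)[of x] that by simp
  have lim: "(\<lambda>k. \<phi> k x) \<longlonglongrightarrow> indicator U x" if "x \<in> X" for x
  proof (cases "x \<in> U")
    case True
    then have g_pos: "g x > 0" using g(3) that by blast
    obtain N where N: "real N > 1 / g x" using reals_Archimedean2 by blast
    have "\<phi> k x = 1" if "k \<ge> N" for k
    proof -
      have "1 < real N * g x" using N g_pos by (simp add: field_simps)
      also have "\<dots> \<le> real k * g x" using that g(2) by (intro mult_right_mono) auto
      finally show ?thesis by (simp add: \<phi>_def)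
    qed
    then have "\<forall>\<^sub>F k in sequentially. \<phi> k x = 1" unfolding eventually_sequentially by blast
    then show ?thesis using True by (simp add: tendsto_eventually)
  qed (use gU that in \<open>simp add: \<phi>_def\<close>)
  show ?thesis
  proof (rule that)
    show "continuous_on X (\<phi> k)" for k unfolding \<phi>_def by (intro continuous_intros g(1))
    show "0 \<le> \<phi> k x \<and> \<phi> k x \<le> indicator U x" if "x \<in> X" for k x
      using g(2)[of x] gU[OF that] by (cases "x \<in> U") (auto simp: \<phi>_def)
    show "mono (\<lambda>k. \<phi> k x)" for x
      using g(2)[of x] by (auto simp: mono_def \<phi>_def mult_right_mono min.coboundedI2)
  qed (rule lim)
qed

section \<open>Measures determined by open sets or by integrals\<close>

lemma sets_restrict_borel_generator:
  fixes X :: "'a::topological_space set"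
  assumes "closed X"
  shows "sets (restrict_space borel X) = sigma_sets X ((\<inter>) X ` {U. open U})"
proof -
  have "X \<in> sigma_sets UNIV {U. open U}"
    using assms by (metis borel_closed borel_def sets_measure_of subset_UNIV Pow_UNIV)
  then have "(\<inter>) X ` sigma_sets UNIV {U. open U} = sigma_sets X ((\<inter>) X ` {U. open U})"
    by (rule sigma_sets_Int) simp
  then show ?thesis by (simp add: sets_restrict_space borel_def)
qed

lemma measure_eqI_open:
  fixes X :: "'a::metric_space set"
  assumes X: "closed X"
    and M: "prob_space M" "sets M = sets (restrict_space borel X)"
    and N: "sets N = sets (restrict_space borel X)"
    and eq: "\<And>U. open U \<Longrightarrow> emeasure M (X \<inter> U) = emeasure N (X \<inter> U)"
  shows "M = N"
proof (rule measure_eqI_generator_eq)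
  interpret M: prob_space M by (rule M(1))
  show "Int_stable ((\<inter>) X ` {U. open U})"
  proof (rule Int_stableI)
    fix a b assume "a \<in> (\<inter>) X ` {U. open U}" "b \<in> (\<inter>) X ` {U. open U}"
    then obtain U V where "open U" "open V" "a = X \<inter> U" "b = X \<inter> V" by blast
    then show "a \<inter> b \<in> (\<inter>) X ` {U. open U}"
      by (intro image_eqI[of _ _ "U \<inter> V"]) auto
  qed
  show "sets M = sigma_sets X ((\<inter>) X ` {U. open U})" "sets N = sigma_sets X ((\<inter>) X ` {U. open U})"
    using sets_restrict_borel_generator[OF X] M N by auto
  show "range (\<lambda>_. X) \<subseteq> (\<inter>) X ` {U. open U}" by (auto intro: image_eqI[of _ _ UNIV])
qed (use eq prob_space.finite_measure[OF M(1)] in \<open>auto simp: finite_measure.emeasure_finite\<close>)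

text \<open>As the total masses agree, taking complements reverses the inequality on closed sets.
  Every relatively open set is an increasing union of closed ones, so the reverse inequality holds
  on open sets too.\<close>

lemma measure_eqI_open_le:
  fixes X :: "'a::metric_space set"
  assumes X: "closed X"
    and M: "prob_space M" "sets M = sets (restrict_space borel X)"
    and N: "prob_space N" "sets N = sets (restrict_space borel X)"
    and le: "\<And>U. open U \<Longrightarrow> measure M (X \<inter> U) \<le> measure N (X \<inter> U)"
  shows "M = N"
proof (rule measure_eqI_open[OF X M N(2)])
  interpret M: prob_space M by (rule M(1))
  interpret N: prob_space N by (rule N(1))
  have spaces: "space M = X" "space N = X"
    using sets_eq_imp_space_eq[OF M(2)] sets_eq_imp_space_eq[OF N(2)]
    by (simp_all add: space_restrict_space)
  have sets: "X \<inter> A \<in> sets M" "X \<inter> A \<in> sets N" if "A \<in> sets borel" for A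
    using that M(2) N(2) by (auto simp: sets_restrict_space)
  fix U :: "'a set" assume U: "open U"
  obtain \<phi> :: "nat \<Rightarrow> 'a \<Rightarrow> real" where \<phi>: "\<And>k. continuous_on X (\<phi> k)"
    "\<And>k x. x \<in> X \<Longrightarrow> 0 \<le> \<phi> k x \<and> \<phi> k x \<le> indicator U x"
    "\<And>x. mono (\<lambda>k. \<phi> k x)"
    "\<And>x. x \<in> X \<Longrightarrow> (\<lambda>k. \<phi> k x) \<longlonglongrightarrow> indicator U x"
    using open_indicator_approx[OF X U] by blast
  \<comment> \<open>Superlevel sets of the approximating functions are closed and increase to
    \<open>X \<inter> U\<close>; any threshold strictly between 0 and 1 would do.\<close>
  define F where "F k = {x \<in> X. 1/2 \<le> \<phi> k x}" for k
  have clF: "closed (F k)" for k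
    unfolding F_def using continuous_on_closed_Collect_le[OF _ \<phi>(1) X, of "\<lambda>_. 1/2"] by auto
  have FX: "F k = X \<inter> F k" "F k \<subseteq> X" for k by (auto simp: F_def)
  have setsF: "F k \<in> sets M" "F k \<in> sets N" for k
    using sets[of "F k"] clF FX by (metis borel_closed)+
  have F_le: "measure N (F k) \<le> measure M (F k)" for k
  proof -
    have "X \<inter> (- F k) = X - F k" by blast
    moreover have "measure M (X - F k) = 1 - measure M (F k)"
      "measure N (X - F k) = 1 - measure N (F k)"
      using M.prob_compl[OF setsF(1)] N.prob_compl[OF setsF(2)] spaces by auto
    ultimately show ?thesis using le[of "- F k"] clF by (simp add: open_Compl)
  qed
  have inc: "incseq F"
    using \<phi>(3) by (auto simp: incseq_def F_def mono_def intro: order_trans)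
  have UF: "(\<Union>k. F k) = X \<inter> U"
  proof (intro equalityI subsetI)
    fix x assume "x \<in> (\<Union>k. F k)"
    then obtain k where k: "x \<in> X" "1/2 \<le> \<phi> k x" by (auto simp: F_def)
    then have "x \<in> U" using \<phi>(2)[of x k] by (cases "x \<in> U") auto
    then show "x \<in> X \<inter> U" using k by simp
  next
    fix x assume x: "x \<in> X \<inter> U"
    then have "(\<lambda>k. \<phi> k x) \<longlonglongrightarrow> 1" using \<phi>(4)[of x] by simp
    then have "\<forall>\<^sub>F k in sequentially. 1/2 < \<phi> k x" by (rule order_tendstoD) simp
    then obtain k where "1/2 < \<phi> k x" by (auto simp: eventually_sequentially)
    then show "x \<in> (\<Union>k. F k)" using x by (auto simp: F_def intro: less_imp_le)
  qed
  have "measure N (X \<inter> U) \<le> measure M (X \<inter> U)"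
  proof (rule LIMSEQ_le)
    show "(\<lambda>k. measure N (F k)) \<longlonglongrightarrow> measure N (X \<inter> U)"
      using N.finite_Lim_measure_incseq[OF _ inc] setsF UF by auto
    show "(\<lambda>k. measure M (F k)) \<longlonglongrightarrow> measure M (X \<inter> U)"
      using M.finite_Lim_measure_incseq[OF _ inc] setsF UF by auto
  qed (use F_le in blast)
  then have "measure N (X \<inter> U) = measure M (X \<inter> U)" using le[OF U] by simp
  then show "emeasure M (X \<inter> U) = emeasure N (X \<inter> U)"
    by (simp add: M.emeasure_eq_measure N.emeasure_eq_measure)
qed

lemma continuous_on_imp_borel_measurable_restrict:
  fixes X :: "'a::metric_space set" and \<phi> :: "'a \<Rightarrow> 'b::topological_space"
  assumes "sets M = sets (restrict_space borel X)" "continuous_on X \<phi>"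
  shows "\<phi> \<in> borel_measurable M"
  using borel_measurable_continuous_on_restrict[OF assms(2)] measurable_cong_sets[OF assms(1) refl]
  by blast

text \<open>Dominated convergence along continuous approximations of an indicator recovers the mass
  of every relatively open set.\<close>

lemma measure_eqI_continuous_integral:
  fixes X :: "'a::metric_space set"
  assumes X: "closed X"
    and M: "prob_space M" "sets M = sets (restrict_space borel X)"
    and N: "prob_space N" "sets N = sets (restrict_space borel X)"
    and eq: "\<And>\<phi> :: 'a \<Rightarrow> real. continuous_on X \<phi> \<Longrightarrow> integral\<^sup>L M \<phi> = integral\<^sup>L N \<phi>"
  shows "M = N"
proof (rule measure_eqI_open_le[OF X M N])
  fix U :: "'a set" assume U: "open U"
  obtain \<phi> :: "nat \<Rightarrow> 'a \<Rightarrow> real" where \<phi>: "\<And>k. continuous_on X (\<phi> k)"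
    "\<And>k x. x \<in> X \<Longrightarrow> 0 \<le> \<phi> k x \<and> \<phi> k x \<le> indicator U x"
    "\<And>x. mono (\<lambda>k. \<phi> k x)"
    "\<And>x. x \<in> X \<Longrightarrow> (\<lambda>k. \<phi> k x) \<longlonglongrightarrow> indicator U x"
    using open_indicator_approx[OF X U] by blast
  have lim: "(\<lambda>k. integral\<^sup>L P (\<phi> k)) \<longlonglongrightarrow> measure P (X \<inter> U)"
    if P: "prob_space P" "sets P = sets (restrict_space borel X)" for P
  proof -
    interpret P: prob_space P by (rule P(1))
    have sp: "space P = X"
      using sets_eq_imp_space_eq[OF P(2)] by (simp add: space_restrict_space)
    have XU: "X \<inter> U \<in> sets P" using P(2) U by (auto simp: sets_restrict_space)
    have "(\<lambda>k. integral\<^sup>L P (\<phi> k)) \<longlonglongrightarrow> integral\<^sup>L P (indicator (X \<inter> U))"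
    proof (rule integral_dominated_convergence[where w = "\<lambda>_. 1"])
      show "AE x in P. (\<lambda>k. \<phi> k x) \<longlonglongrightarrow> indicator (X \<inter> U) x"
        using \<phi>(4) sp by (intro AE_I2) (auto simp: indicator_def)
      have "norm (\<phi> k x) \<le> 1" if "x \<in> X" for k x
        using \<phi>(2)[OF that, of k] by (cases "x \<in> U") auto
      then show "AE x in P. norm (\<phi> k x) \<le> 1" for k
        using sp by (intro AE_I2) auto
    qed (use XU continuous_on_imp_borel_measurable_restrict[OF P(2) \<phi>(1)] in auto)
    then show ?thesis using XU by simp
  qed
  show "measure M (X \<inter> U) \<le> measure N (X \<inter> U)"
    using LIMSEQ_unique[OF lim[OF M]] lim[OF N] eq[OF \<phi>(1)] by simp
qed

section \<open>Birkhoff averages under an invariant measure\<close>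

lemma tds_measurable:
  fixes X :: "'a::metric_space set"
  assumes tds: "tds X f" and M: "sets M = sets (restrict_space borel X)"
  shows "f \<in> M \<rightarrow>\<^sub>M M"
proof -
  have "space M = X" using sets_eq_imp_space_eq[OF M] by (simp add: space_restrict_space)
  then have "f \<in> M \<rightarrow>\<^sub>M restrict_space borel X"
    using tds continuous_on_imp_borel_measurable_restrict[OF M, of f]
    by (intro measurable_restrict_space2) (auto simp: tds_def)
  then show ?thesis using measurable_cong_sets[OF refl M] by blast
qed

lemma invariant_integral_birkhoff:
  fixes X :: "'a::metric_space set"
  assumes tds: "tds X f" and inv: "invariant_prob_measure X f M"
    and \<phi>: "continuous_on X \<phi>" and n: "n > 0"
  shows "integrable M (\<lambda>x. birkhoff_sum f \<phi> n x / real n)"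
    and "(\<integral>x. birkhoff_sum f \<phi> n x / real n \<partial>M) = integral\<^sup>L M \<phi>"
proof -
  interpret M: prob_space M using inv by (simp add: invariant_prob_measure_def)
  have M: "space M = X" "sets M = sets (restrict_space borel X)"
    "\<And>A. A \<in> sets M \<Longrightarrow> emeasure M (f -` A \<inter> X) = emeasure M A"
    using inv by (auto simp: invariant_prob_measure_def)
  have X: "compact X" using tds by (simp add: tds_def)
  have f: "f \<in> M \<rightarrow>\<^sub>M M" by (rule tds_measurable[OF tds M(2)])
  have distr: "distr M M f = M"
    by (rule measure_eqI) (use f M in \<open>auto simp: emeasure_distr\<close>)
  have int: "integrable M \<psi>" if "continuous_on X \<psi>" for \<psi> :: "'a \<Rightarrow> real"
  proof -
    obtain B where B: "B > 0" "\<And>x. x \<in> X \<Longrightarrow> \<bar>\<psi> x\<bar> \<le> B"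
      using compact_continuous_real_bound[OF X \<open>continuous_on X \<psi>\<close>] by blast
    then show ?thesis
      using continuous_on_imp_borel_measurable_restrict[OF M(2) \<open>continuous_on X \<psi>\<close>] M(1)
      by (intro M.integrable_const_bound[of _ B]) auto
  qed
  have cont: "continuous_on X (\<lambda>x. \<phi> ((f ^^ i) x))" for i
    using funpow_continuous_on[OF tds, of i]
    by (intro continuous_on_compose2[OF \<phi>]) auto
  have "(\<integral>x. \<phi> ((f ^^ i) x) \<partial>M) = integral\<^sup>L M \<phi>" for i
  proof (induction i)
    case (Suc i)
    have "integral\<^sup>L M (\<lambda>x. \<phi> ((f ^^ i) x)) = integral\<^sup>L (distr M M f) (\<lambda>x. \<phi> ((f ^^ i) x))"
      by (simp add: distr)
    also have "\<dots> = (\<integral>x. \<phi> ((f ^^ i) (f x)) \<partial>M)"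
      by (rule integral_distr[OF f continuous_on_imp_borel_measurable_restrict[OF M(2) cont]])
    finally show ?case using Suc.IH by (simp add: funpow_swap1)
  qed simp
  then show "(\<integral>x. birkhoff_sum f \<phi> n x / real n \<partial>M) = integral\<^sup>L M \<phi>"
    unfolding birkhoff_sum_def using n int[OF cont] by simp
  show "integrable M (\<lambda>x. birkhoff_sum f \<phi> n x / real n)"
    unfolding birkhoff_sum_def using int[OF cont] by simp
qed

text \<open>By invariance every Birkhoff average has the same integral as \<open>\<phi>\<close>,
  while the averages approach \<open>c\<close> uniformly.\<close>

lemma invariant_integral_eq_uniform_limit:
  fixes X :: "'a::metric_space set"
  assumes tds: "tds X f" and inv: "invariant_prob_measure X f M"
    and \<phi>: "continuous_on X \<phi>"
    and lim: "uniform_limit X (\<lambda>n x. birkhoff_sum f \<phi> n x / real n) (\<lambda>_. c) sequentially"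
  shows "integral\<^sup>L M \<phi> = c"
proof (rule ccontr)
  interpret M: prob_space M using inv by (simp add: invariant_prob_measure_def)
  have sp: "space M = X" using inv by (simp add: invariant_prob_measure_def)
  define e where "e = \<bar>integral\<^sup>L M \<phi> - c\<bar> / 2"
  assume "integral\<^sup>L M \<phi> \<noteq> c"
  then have "e > 0" by (simp add: e_def)
  have "\<forall>\<^sub>F n in sequentially. n > 0 \<and> (\<forall>x\<in>X. dist (birkhoff_sum f \<phi> n x / real n) c < e)"
    by (intro eventually_conj eventually_gt_at_top uniform_limitD[OF lim \<open>e > 0\<close>])
  then obtain n where n: "n > 0" "\<And>x. x \<in> X \<Longrightarrow> \<bar>birkhoff_sum f \<phi> n x / real n - c\<bar> < e"
    by (auto simp: eventually_sequentially dist_real_def)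
  note I = invariant_integral_birkhoff[OF tds inv \<phi> n(1)]
  have "\<bar>integral\<^sup>L M \<phi> - c\<bar> = \<bar>\<integral>x. birkhoff_sum f \<phi> n x / real n - c \<partial>M\<bar>"
    using I by (simp add: M.prob_space)
  also have "\<dots> \<le> (\<integral>x. \<bar>birkhoff_sum f \<phi> n x / real n - c\<bar> \<partial>M)"
    by (rule integral_abs_bound)
  also have "\<dots> \<le> (\<integral>x. e \<partial>M)"
    using I(1) n(2) sp by (intro integral_mono) (auto intro: less_imp_le)
  also have "\<dots> = e" by (simp add: M.prob_space)
  finally show False using \<open>e > 0\<close> by (simp add: e_def)
qed

subsection \<open>The measure of a positive functional\<close>

text \<open>The setting of the Riesz-Markov theorem with total mass 1. \<open>L\<close> is defined
  on all functions but constrained only on those continuous on \<open>X\<close>, and by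
  \<open>mono\<close> it sees only their values on \<open>X\<close>.\<close>

locale normalized_positive_functional =
  fixes X :: "'a::metric_space set" and L :: "('a \<Rightarrow> real) \<Rightarrow> real"
  assumes compact: "compact X"
    and add: "continuous_on X \<phi> \<Longrightarrow> continuous_on X \<psi> \<Longrightarrow> L (\<lambda>x. \<phi> x + \<psi> x) = L \<phi> + L \<psi>"
    and mono: "continuous_on X \<phi> \<Longrightarrow> continuous_on X \<psi> \<Longrightarrow> (\<And>x. x \<in> X \<Longrightarrow> \<phi> x \<le> \<psi> x) \<Longrightarrow> L \<phi> \<le> L \<psi>"
    and const: "L (\<lambda>_. c) = c"
begin

text \<open>Functions vanish off \<open>U\<close> instead of having support inside \<open>U\<close>.
  Where a support inside \<open>U\<close> is needed, \<open>\<phi>\<close> is replaced by the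
  positive part of \<open>\<phi> - e\<close>, at a cost of \<open>e\<close>.\<close>

definition subordinate :: "'a set \<Rightarrow> ('a \<Rightarrow> real) set" where
  "subordinate U = {\<phi>. continuous_on X \<phi> \<and> (\<forall>x\<in>X. 0 \<le> \<phi> x \<and> \<phi> x \<le> 1 \<and> (x \<notin> U \<longrightarrow> \<phi> x = 0))}"

definition content :: "'a set \<Rightarrow> ennreal" where
  "content U = (SUP \<phi>\<in>subordinate U. ennreal (L \<phi>))"

definition outer :: "'a set \<Rightarrow> ennreal" where
  "outer A = (INF U\<in>{U. open U \<and> A \<subseteq> U}. content U)"

lemma zero_subordinate: "(\<lambda>_. 0) \<in> subordinate U"
  by (simp add: subordinate_def)

lemma nonneg: "continuous_on X \<phi> \<Longrightarrow> (\<And>x. x \<in> X \<Longrightarrow> 0 \<le> \<phi> x) \<Longrightarrow> 0 \<le> L \<phi>"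
  using mono[of "\<lambda>_. 0" \<phi>] const[of 0] by simp

lemma sum:
  assumes "finite I" "\<And>i. i \<in> I \<Longrightarrow> continuous_on X (\<phi> i)"
  shows "L (\<lambda>x. \<Sum>i\<in>I. \<phi> i x) = (\<Sum>i\<in>I. L (\<phi> i))"
  using assms
proof (induction I rule: finite_induct)
  case (insert i I)
  then show ?case
    using add[of "\<phi> i" "\<lambda>x. \<Sum>i\<in>I. \<phi> i x"] by (simp add: continuous_on_sum)
qed (simp add: const)

text \<open>The truncated function vanishes outside the compact set where
  \<open>\<phi> \<ge> e\<close>; this is the passage to compact support.\<close>

lemma le_add_positive_part:
  assumes "continuous_on X \<phi>"
  shows "L \<phi> \<le> e + L (\<lambda>x. max 0 (\<phi> x - e))"
proof -
  have c: "continuous_on X (\<lambda>x. max 0 (\<phi> x - e))" by (intro continuous_intros assms)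
  have "L \<phi> \<le> L (\<lambda>x. e + max 0 (\<phi> x - e))"
    by (rule mono[OF assms], intro continuous_intros c) auto
  also have "\<dots> = e + L (\<lambda>x. max 0 (\<phi> x - e))"
    using add[OF continuous_on_const c] const by simp
  finally show ?thesis .
qed

lemma content_upper: "\<phi> \<in> subordinate U \<Longrightarrow> ennreal (L \<phi>) \<le> content U"
  unfolding content_def by (rule SUP_upper)

lemma content_mono: "X \<inter> U \<subseteq> V \<Longrightarrow> content U \<le> content V"
  unfolding content_def
  by (rule SUP_subset_mono) (auto simp: subordinate_def)

lemma content_le_1: "content U \<le> 1"
proof -
  have "L \<phi> \<le> 1" if "\<phi> \<in> subordinate U" for \<phi>
    using mono[of \<phi> "\<lambda>_. 1"] that const[of 1] by (simp add: subordinate_def)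
  then show ?thesis unfolding content_def by (auto intro!: SUP_least)
qed

lemma content_UNIV: "content UNIV = 1"
proof (rule antisym[OF content_le_1])
  have "ennreal (L (\<lambda>_. 1)) \<le> content UNIV"
    by (rule content_upper) (simp add: subordinate_def)
  then show "1 \<le> content UNIV" by (simp add: const)
qed

lemma content_empty: "content {} = 0"
proof -
  have "L \<phi> \<le> 0" if "\<phi> \<in> subordinate {}" for \<phi>
    using that mono[of \<phi> "\<lambda>_. 0"] const[of 0] by (simp add: subordinate_def)
  then show ?thesis
    unfolding content_def by (auto intro!: antisym SUP_least simp: ennreal_neg)
qed

text \<open>The positive part of \<open>\<phi> - e\<close> lives on a compact set, which finitely many of the \<open>U i\<close> cover;
  it is split by a partition of unity made of the functions \<open>g i\<close>.\<close>

lemma content_countably_subadditive: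
  fixes U :: "nat \<Rightarrow> 'a set"
  assumes U: "\<And>i. open (U i)"
  shows "content (\<Union>i. U i) \<le> (\<Sum>i. content (U i))"
  unfolding content_def[of "\<Union>i. U i"]
proof (rule SUP_least, rule ennreal_le_epsilon)
  fix \<phi> and e :: real
  assume "\<phi> \<in> subordinate (\<Union>i. U i)" and e: "e > 0"
  then have \<phi>: "continuous_on X \<phi>" "\<And>x. x \<in> X \<Longrightarrow> \<phi> x \<le> 1" "\<And>x. x \<in> X \<Longrightarrow> x \<notin> (\<Union>i. U i) \<Longrightarrow> \<phi> x = 0"
    by (auto simp: subordinate_def)
  have clX: "closed X" using compact by (rule compact_imp_closed)
  define K where "K = {x \<in> X. e \<le> \<phi> x}"
  have "closed K"
    unfolding K_def using continuous_on_closed_Collect_le[OF _ \<phi>(1) clX, of "\<lambda>_. e"] by auto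
  then have K: "compact K" "K \<subseteq> X"
    using compact_Int_closed[OF compact, of K] by (auto simp: K_def Int_absorb1)
  have "K \<subseteq> (\<Union>i. U i)" using \<phi>(3) e by (force simp: K_def)
  then obtain I where I: "finite I" "K \<subseteq> (\<Union>i\<in>I. U i)"
    using compactE_image[OF K(1), of UNIV U] U by auto
  have "\<forall>i. \<exists>g :: 'a \<Rightarrow> real. continuous_on X g \<and> (\<forall>x. 0 \<le> g x) \<and> (\<forall>x\<in>X. 0 < g x \<longleftrightarrow> x \<in> U i)"
    using open_eq_positive_continuous[OF clX U] by metis
  then obtain g :: "nat \<Rightarrow> 'a \<Rightarrow> real" where g: "\<And>i. continuous_on X (g i)" "\<And>i x. 0 \<le> g i x"
    "\<And>i x. x \<in> X \<Longrightarrow> 0 < g i x \<longleftrightarrow> x \<in> U i"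
    by metis
  define s where "s x = (\<Sum>i\<in>I. g i x)" for x
  have s: "continuous_on X s" unfolding s_def by (intro continuous_intros g(1))
  have s_ge: "g i x \<le> s x" if "i \<in> I" for i x
    unfolding s_def using that I(1) g(2) by (intro member_le_sum) auto
  obtain c where c: "c > 0" "\<And>x. x \<in> K \<Longrightarrow> c \<le> s x"
  proof (cases "K = {}")
    case False
    obtain x0 where x0: "x0 \<in> K" "\<And>x. x \<in> K \<Longrightarrow> s x0 \<le> s x"
      using continuous_attains_inf[OF K(1) False continuous_on_subset[OF s K(2)]] by blast
    obtain i where i: "i \<in> I" "x0 \<in> U i" using I(2) x0(1) by blast
    then have "0 < s x0" using g(3)[of x0 i] s_ge[OF i(1), of x0] x0(1) K(2) by auto
    then show ?thesis using that x0 by blast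
  qed (use that[of 1] in auto)
  \<comment> \<open>On \<open>K\<close> the denominator is \<open>s x\<close>, so the functions
    \<open>h i\<close> add up to the truncated \<open>\<phi>\<close>. Off \<open>K\<close> the first
    factor is 0, but \<open>s\<close> may vanish there; the maximum with \<open>c\<close> keeps the
    quotient continuous.\<close>
  define h where "h i x = max 0 (\<phi> x - e) * (g i x / max c (s x))" for i x
  have h_cont: "continuous_on X (h i)" for i
    unfolding h_def using c(1) by (intro continuous_intros \<phi>(1) g(1) s) (metis less_max_iff_disj order_less_irrefl)
  have h_sub: "h i \<in> subordinate (U i)" if "i \<in> I" for i
  proof -
    have "0 \<le> h i x \<and> h i x \<le> 1 \<and> (x \<notin> U i \<longrightarrow> h i x = 0)" if "x \<in> X" for x
    proof (cases "x \<in> U i")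
      case True
      have "0 \<le> max 0 (\<phi> x - e)" "max 0 (\<phi> x - e) \<le> 1" "0 \<le> g i x / max c (s x)" "g i x / max c (s x) \<le> 1"
        using \<phi>(2)[OF that] e c(1) g(2)[of i x] s_ge[OF \<open>i \<in> I\<close>, of x] by auto
      then show ?thesis using True unfolding h_def by (intro conjI mult_nonneg_nonneg mult_le_one) auto
    next
      case False
      then have "g i x = 0" using g(2)[of i x] g(3)[OF that, of i] by simp
      then show ?thesis by (simp add: h_def)
    qed
    then show ?thesis using h_cont by (simp add: subordinate_def)
  qed
  have "max 0 (\<phi> x - e) \<le> (\<Sum>i\<in>I. h i x)" if "x \<in> X" for x
  proof (cases "x \<in> K")
    case True
    then have "max c (s x) = s x" "s x > 0" using c(1) c(2)[of x] by auto
    moreover have "(\<Sum>i\<in>I. h i x) = max 0 (\<phi> x - e) * (s x / max c (s x))"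
      by (simp only: h_def s_def sum_distrib_left sum_divide_distrib)
    ultimately show ?thesis by simp
  next
    case False
    then have "max 0 (\<phi> x - e) = 0" using that by (simp add: K_def)
    then show ?thesis by (simp add: h_def)
  qed
  then have "L (\<lambda>x. max 0 (\<phi> x - e)) \<le> L (\<lambda>x. \<Sum>i\<in>I. h i x)"
    by (intro mono continuous_intros \<phi>(1) h_cont)
  also have "\<dots> = (\<Sum>i\<in>I. L (h i))" by (rule sum[OF I(1) h_cont])
  finally have "L \<phi> \<le> (\<Sum>i\<in>I. L (h i)) + e" using le_add_positive_part[OF \<phi>(1), of e] by simp
  moreover have h0: "0 \<le> L (h i)" if "i \<in> I" for i
    using h_sub[OF that] by (intro nonneg) (auto simp: subordinate_def)
  ultimately have "ennreal (L \<phi>) \<le> ennreal (\<Sum>i\<in>I. L (h i)) + ennreal e"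
    using e by (subst ennreal_plus[symmetric]) (auto intro: ennreal_leI sum_nonneg)
  also have "ennreal (\<Sum>i\<in>I. L (h i)) = (\<Sum>i\<in>I. ennreal (L (h i)))"
    using h0 by (rule sum_ennreal[symmetric])
  also have "(\<Sum>i\<in>I. ennreal (L (h i))) \<le> (\<Sum>i\<in>I. content (U i))"
    by (intro sum_mono content_upper h_sub)
  also have "\<dots> \<le> (\<Sum>i. content (U i))" by (intro sum_le_suminf I) auto
  finally show "ennreal (L \<phi>) \<le> (\<Sum>i. content (U i)) + ennreal e" by (simp add: add_right_mono)
qed

section \<open>The outer measure and its Caratheodory measurable sets\<close>

lemma outer_le_content: "open U \<Longrightarrow> A \<subseteq> U \<Longrightarrow> outer A \<le> content U"
  unfolding outer_def by (rule INF_lower) simp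

lemma outer_close: "outer A < r \<Longrightarrow> \<exists>U. open U \<and> A \<subseteq> U \<and> content U < r"
  unfolding outer_def INF_less_iff by blast

lemma outer_mono: "A \<subseteq> B \<Longrightarrow> outer A \<le> outer B"
  unfolding outer_def by (rule INF_superset_mono) auto

text \<open>The content depends only on the trace on \<open>X\<close>, so no open superset of
  \<open>X \<inter> U\<close> has content smaller than that of \<open>U\<close>.\<close>

lemma outer_open: "open U \<Longrightarrow> outer (X \<inter> U) = content U"
  by (rule antisym[OF outer_le_content])
    (auto simp: outer_def intro!: INF_greatest content_mono)

lemma outer_measure_space_outer: "outer_measure_space (Pow X) outer"
  unfolding outer_measure_space_def
proof (intro conjI)
  show "positive (Pow X) outer"
    using outer_open[of "{}"] content_empty by (simp add: positive_def)
  show "increasing (Pow X) outer"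
    unfolding increasing_def by (auto intro: outer_mono)
  show "countably_subadditive (Pow X) outer"
  proof (simp add: countably_subadditive_def, safe)
    fix A :: "nat \<Rightarrow> 'a set"
    show "outer (\<Union>i. A i) \<le> (\<Sum>i. outer (A i))"
    proof (rule ennreal_le_epsilon)
      fix e :: real assume e: "0 < e" and fin: "(\<Sum>i. outer (A i)) < top"
      \<comment> \<open>Finiteness of the sum makes every \<open>outer (A i)\<close> finite, so that
        adding a positive amount is a strict increase; the amounts total \<open>e\<close>.\<close>
      then have "outer (A i) < outer (A i) + e * (1/2) ^ Suc i" for i
        by (auto simp add: less_top dest!: ennreal_suminf_lessD)
      then have "\<exists>U. open U \<and> A i \<subseteq> U \<and> content U < outer (A i) + e * (1/2) ^ Suc i" for i
        by (rule outer_close)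
      then obtain U where U: "\<And>i. open (U i)" "\<And>i. A i \<subseteq> U i"
        "\<And>i. content (U i) < outer (A i) + e * (1/2) ^ Suc i"
        by metis
      have "outer (\<Union>i. A i) \<le> content (\<Union>i. U i)"
        using U by (intro outer_le_content) auto
      also have "\<dots> \<le> (\<Sum>i. content (U i))" by (rule content_countably_subadditive[OF U(1)])
      also have "\<dots> \<le> (\<Sum>i. outer (A i) + e * (1/2) ^ Suc i)"
        using U(3) by (intro suminf_le less_imp_le) auto
      also have "\<dots> = (\<Sum>i. outer (A i)) + (\<Sum>i. ennreal e * ennreal ((1/2) ^ Suc i))"
        using e by (subst suminf_add[symmetric])
          (auto simp del: ennreal_suminf_cmult simp add: ennreal_mult[symmetric])
      also have "\<dots> = (\<Sum>i. outer (A i)) + e"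
        unfolding ennreal_suminf_cmult
        by (subst suminf_ennreal_eq[OF zero_le_power power_half_series]) auto
      finally show "outer (\<Union>i. A i) \<le> (\<Sum>i. outer (A i)) + e" .
    qed
  qed
qed

text \<open>Truncating \<open>\<phi>\<close> by \<open>e\<close> confines it to a closed
  \<open>K\<close> on which every \<open>\<psi>\<close> subordinate to \<open>V - K\<close>
  vanishes. The two functions are never both nonzero, so their sum is still at most 1 and
  subordinate to \<open>V\<close>.\<close>

lemma content_split:
  assumes "open U" "open V"
  shows "content (V \<inter> U) + outer (X \<inter> (V - U)) \<le> content V"
proof -
  have "ennreal (L \<phi>) + outer (X \<inter> (V - U)) \<le> content V"
    if "\<phi> \<in> subordinate (V \<inter> U)" for \<phi>
  proof (rule ennreal_le_epsilon)
    fix e :: real assume e: "e > 0"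
    have \<phi>: "continuous_on X \<phi>" "\<And>x. x \<in> X \<Longrightarrow> 0 \<le> \<phi> x \<and> \<phi> x \<le> 1"
      "\<And>x. x \<in> X \<Longrightarrow> x \<notin> V \<inter> U \<Longrightarrow> \<phi> x = 0"
      using that by (auto simp: subordinate_def)
    define K where "K = {x \<in> X. e \<le> \<phi> x}"
    have clK: "closed K"
      unfolding K_def
      using continuous_on_closed_Collect_le[OF _ \<phi>(1) compact_imp_closed[OF compact], of "\<lambda>_. e"]
      by auto
    have "X \<inter> (V - U) \<subseteq> V - K"
    proof
      fix x assume x: "x \<in> X \<inter> (V - U)"
      then have "\<phi> x = 0" using \<phi>(3)[of x] by simp
      then show "x \<in> V - K" using x e by (simp add: K_def)
    qed
    then have "outer (X \<inter> (V - U)) \<le> content (V - K)"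
      using clK assms by (intro outer_le_content) auto
    moreover have "ennreal (L \<phi>) + content (V - K) \<le> content V + ennreal e"
    proof -
      have "ennreal (L \<phi>) + ennreal (L \<psi>) \<le> content V + ennreal e"
        if "\<psi> \<in> subordinate (V - K)" for \<psi>
      proof -
        have \<psi>: "continuous_on X \<psi>" "\<And>x. x \<in> X \<Longrightarrow> 0 \<le> \<psi> x \<and> \<psi> x \<le> 1"
          "\<And>x. x \<in> X \<Longrightarrow> x \<notin> V - K \<Longrightarrow> \<psi> x = 0"
          using that by (auto simp: subordinate_def)
        have c: "continuous_on X (\<lambda>x. max 0 (\<phi> x - e))" by (intro continuous_intros \<phi>(1))
        have "0 \<le> max 0 (\<phi> x - e) + \<psi> x \<and> max 0 (\<phi> x - e) + \<psi> x \<le> 1 \<and>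
            (x \<notin> V \<longrightarrow> max 0 (\<phi> x - e) + \<psi> x = 0)" if x: "x \<in> X" for x
        proof (cases "x \<in> K")
          case True
          then show ?thesis using \<psi>(3)[OF x] \<phi>(2,3)[OF x] e by (auto simp: K_def)
        next
          case False
          then have "max 0 (\<phi> x - e) = 0" using x by (simp add: K_def)
          then show ?thesis using \<psi>(2,3)[OF x] by auto
        qed
        then have "(\<lambda>x. max 0 (\<phi> x - e) + \<psi> x) \<in> subordinate V"
          using continuous_on_add[OF c \<psi>(1)] unfolding subordinate_def by blast
        then have *: "ennreal (L (\<lambda>x. max 0 (\<phi> x - e)) + L \<psi>) \<le> content V"
          using content_upper add[OF c \<psi>(1)] by fastforce
        have pos: "0 \<le> L (\<lambda>x. max 0 (\<phi> x - e))" "0 \<le> L \<psi>" "0 \<le> L \<phi>"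
          using nonneg[OF c] nonneg[OF \<psi>(1)] nonneg[OF \<phi>(1)] \<psi>(2) \<phi>(2) by auto
        have "ennreal (L \<phi>) + ennreal (L \<psi>) = ennreal (L \<phi> + L \<psi>)" using pos by simp
        also have "\<dots> \<le> ennreal ((L (\<lambda>x. max 0 (\<phi> x - e)) + L \<psi>) + e)"
          using le_add_positive_part[OF \<phi>(1), of e] by (intro ennreal_leI) simp
        also have "\<dots> = ennreal (L (\<lambda>x. max 0 (\<phi> x - e)) + L \<psi>) + ennreal e"
          using pos e by (intro ennreal_plus) auto
        also have "\<dots> \<le> content V + ennreal e" using * by (rule add_right_mono)
        finally show ?thesis .
      qed
      moreover have "subordinate (V - K) \<noteq> {}" using zero_subordinate by blast
      ultimately show ?thesis
        unfolding content_def[of "V - K"] by (subst ennreal_SUP_add_right) (auto intro: SUP_least)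
    qed
    ultimately show "ennreal (L \<phi>) + outer (X \<inter> (V - U)) \<le> content V + ennreal e"
      by (meson add_left_mono order_trans)
  qed
  moreover have "subordinate (V \<inter> U) \<noteq> {}" using zero_subordinate by blast
  ultimately show ?thesis
    unfolding content_def[of "V \<inter> U"]
    by (subst ennreal_SUP_add_left[symmetric]) (auto intro: SUP_least)
qed

text \<open>One half of Caratheodory's criterion for \<open>A\<close> reduces to open
  \<open>V \<supseteq> A\<close>, where it is \<open>content_split\<close>; the other half is
  subadditivity.\<close>

lemma open_in_lambda_system:
  assumes "open U"
  shows "X \<inter> U \<in> lambda_system X (Pow X) outer"
  unfolding algebra.lambda_system_eq[OF algebra_Pow]
proof (safe)
  fix A assume A: "A \<subseteq> X"
  show "outer (A \<inter> (X \<inter> U)) + outer (A - X \<inter> U) = outer A"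
  proof (rule antisym)
    show "outer (A \<inter> (X \<inter> U)) + outer (A - X \<inter> U) \<le> outer A"
      unfolding outer_def[of A]
    proof (rule INF_greatest)
      fix V assume "V \<in> {V. open V \<and> A \<subseteq> V}"
      then have V: "open V" "A \<subseteq> V" by auto
      have "outer (A \<inter> (X \<inter> U)) \<le> content (V \<inter> U)"
        using V assms by (intro outer_le_content) auto
      moreover have "outer (A - X \<inter> U) \<le> outer (X \<inter> (V - U))"
        using A V(2) by (intro outer_mono) auto
      ultimately show "outer (A \<inter> (X \<inter> U)) + outer (A - X \<inter> U) \<le> content V"
        using content_split[OF assms V(1)] add_mono order_trans by blast
    qed
    interpret algebra X "Pow X" by (rule algebra_Pow)
    have "subadditive (Pow X) outer"
      using outer_measure_space_outer
      by (auto simp: outer_measure_space_def intro: countably_subadditive_subadditive)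
    then have "outer ((A \<inter> (X \<inter> U)) \<union> (A - X \<inter> U)) \<le> outer (A \<inter> (X \<inter> U)) + outer (A - X \<inter> U)"
      using A by (intro subadditiveD) auto
    then show "outer A \<le> outer (A \<inter> (X \<inter> U)) + outer (A - X \<inter> U)"
      by (simp add: Int_Diff_Un)
  qed
qed

text \<open>The Caratheodory measurable sets form a sigma-algebra that contains the relatively open
  sets, so \<open>outer\<close> restricts to a measure on the Borel sets of
  \<open>X\<close>.\<close>

theorem representing_measure:
  "\<exists>M. prob_space M \<and> space M = X \<and> sets M = sets (restrict_space borel X) \<and>
     (\<forall>U. open U \<longrightarrow> emeasure M (X \<inter> U) = content U)"
proof -
  let ?G = "(\<inter>) X ` {U. open U}"
  have G: "?G \<subseteq> Pow X" by blast
  have ms: "measure_space X (lambda_system X (Pow X) outer) outer"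
    using sigma_algebra.caratheodory_lemma[OF sigma_algebra_Pow outer_measure_space_outer] .
  have "sigma_sets X ?G \<subseteq> lambda_system X (Pow X) outer"
    using ms open_in_lambda_system
    by (intro sigma_algebra.sigma_sets_subset) (auto simp: measure_space_def)
  then have ms': "measure_space X (sigma_sets X ?G) outer"
    using measure_down[OF ms sigma_algebra_sigma_sets[OF G]] by blast
  define M where "M = measure_of X ?G outer"
  have M: "space M = X" "sets M = sigma_sets X ?G"
    using G by (simp_all add: M_def)
  have em: "emeasure M (X \<inter> U) = content U" if "open U" for U
  proof -
    have "emeasure M (X \<inter> U) = outer (X \<inter> U)"
      using ms' M(2) that G by (intro emeasure_measure_of[OF M_def]) (auto simp: measure_space_def)
    then show ?thesis using outer_open[OF that] by simp
  qed
  have "prob_space M"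
    using em[of UNIV] content_UNIV M(1) by (intro prob_spaceI) simp
  then show ?thesis
    using em M sets_restrict_borel_generator[OF compact_imp_closed[OF compact]] by metis
qed

end

subsection \<open>Unique ergodicity\<close>

lemma birkhoff_sum_comp: "birkhoff_sum f (\<lambda>x. \<phi> (f x)) n x = birkhoff_sum f \<phi> n (f x)"
  unfolding birkhoff_sum_def by (intro sum.cong) (simp_all add: funpow_swap1)

text \<open>Pointwise limits of averages give a normalized positive functional. That the limits are
  constant on \<open>X\<close> makes it invariant under composition with \<open>f\<close>, and
  invariance passes to the representing measure.\<close>

theorem uniform_birkhoff_limits_invariant_measure_exists:
  fixes X :: "'a::metric_space set"
  assumes tds: "tds X f"
    and lim: "\<And>\<phi>. continuous_on X \<phi> \<Longrightarrow>
      \<exists>c. uniform_limit X (\<lambda>n x. birkhoff_sum f \<phi> n x / real n) (\<lambda>_. c) sequentially"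
  shows "\<exists>M. invariant_prob_measure X f M"
proof -
  have X: "compact X" "continuous_on X f" "f ` X \<subseteq> X" using tds by (auto simp: tds_def)
  obtain x0 where x0: "x0 \<in> X" using tds by (auto simp: tds_def)
  define L where "L \<phi> = lim (\<lambda>n. birkhoff_sum f \<phi> n x0 / real n)" for \<phi>
  have L: "(\<lambda>n. birkhoff_sum f \<phi> n x / real n) \<longlonglongrightarrow> L \<phi>" if \<phi>: "continuous_on X \<phi>" and "x \<in> X" for \<phi> x
  proof -
    obtain c where c: "uniform_limit X (\<lambda>n x. birkhoff_sum f \<phi> n x / real n) (\<lambda>_. c) sequentially"
      using lim[OF \<phi>] by blast
    show ?thesis
      using tendsto_uniform_limitI[OF c \<open>x \<in> X\<close>] limI[OF tendsto_uniform_limitI[OF c x0]]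
      by (simp add: L_def)
  qed
  interpret normalized_positive_functional X L
  proof
    fix \<phi> \<psi> :: "'a \<Rightarrow> real" assume \<phi>: "continuous_on X \<phi>" and \<psi>: "continuous_on X \<psi>"
    have "(\<lambda>n. birkhoff_sum f (\<lambda>x. \<phi> x + \<psi> x) n x0 / real n) \<longlonglongrightarrow> L \<phi> + L \<psi>"
      using tendsto_add[OF L[OF \<phi> x0] L[OF \<psi> x0]]
      by (simp add: birkhoff_sum_def sum.distrib add_divide_distrib)
    then show "L (\<lambda>x. \<phi> x + \<psi> x) = L \<phi> + L \<psi>" unfolding L_def by (rule limI)
    assume le: "\<And>x. x \<in> X \<Longrightarrow> \<phi> x \<le> \<psi> x"
    show "L \<phi> \<le> L \<psi>"
    proof (rule LIMSEQ_le[OF L[OF \<phi> x0] L[OF \<psi> x0]])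
      show "\<exists>N. \<forall>n\<ge>N. birkhoff_sum f \<phi> n x0 / real n \<le> birkhoff_sum f \<psi> n x0 / real n"
        unfolding birkhoff_sum_def
        by (intro exI allI impI divide_right_mono sum_mono le funpow_in[OF tds x0]) simp
    qed
  next
    fix c :: real
    have "(\<lambda>n. birkhoff_sum f (\<lambda>_. c) n x0 / real n) \<longlonglongrightarrow> c"
      by (rule tendsto_eventually)
        (use eventually_gt_at_top[of "0::nat"] in eventually_elim, simp add: birkhoff_sum_def)
    then show "L (\<lambda>_. c) = c" unfolding L_def by (rule limI)
  qed (rule X(1))
  obtain M where M: "prob_space M" "space M = X" "sets M = sets (restrict_space borel X)"
    "\<And>U. open U \<Longrightarrow> emeasure M (X \<inter> U) = content U"
    using representing_measure by blast
  interpret M: prob_space M by (rule M(1))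
  have f: "f \<in> M \<rightarrow>\<^sub>M M" by (rule tds_measurable[OF tds M(3)])
  have "M = distr M M f"
  proof (rule measure_eqI_open_le[OF compact_imp_closed[OF X(1)] M(1,3) M.prob_space_distr[OF f]])
    fix U :: "'a set" assume U: "open U"
    obtain V where V: "open V" "V \<inter> X = f -` U \<inter> X"
      using X(2) U unfolding continuous_on_open_invariant by blast
    \<comment> \<open>Composition with \<open>f\<close> sends functions subordinate to
      \<open>U\<close> to functions subordinate to the preimage without changing \<open>L\<close>.
      This gives one inequality only, which is enough between probability measures.\<close>
    have "content U \<le> content V"
      unfolding content_def[of U]
    proof (rule SUP_least)
      fix \<phi> assume \<phi>: "\<phi> \<in> subordinate U"
      then have c: "continuous_on X \<phi>" by (simp add: subordinate_def)
      have c': "continuous_on X (\<lambda>x. \<phi> (f x))"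
        using continuous_on_compose2[OF c X(2,3)] .
      \<comment> \<open>Averages of the composition at \<open>x0\<close> are averages of
        \<open>\<phi>\<close> at \<open>f x0\<close>, and both base points have the same
        limit.\<close>
      have "L (\<lambda>x. \<phi> (f x)) = L \<phi>"
        using LIMSEQ_unique[OF L[OF c' x0]] L[OF c, of "f x0"] x0 X(3)
        by (auto simp: birkhoff_sum_comp)
      moreover have "(\<lambda>x. \<phi> (f x)) \<in> subordinate V"
        using \<phi> c' V(2) X(3) unfolding subordinate_def by blast
      ultimately show "ennreal (L \<phi>) \<le> content V" using content_upper by metis
    qed
    then have "emeasure M (X \<inter> U) \<le> emeasure M (X \<inter> V)" using M(4) U V(1) by simp
    also have "\<dots> = emeasure (distr M M f) (X \<inter> U)"
    proof -
      have "X \<inter> U \<in> sets M" using M(3) U by (auto simp: sets_restrict_space)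
      moreover have "f -` (X \<inter> U) \<inter> X = X \<inter> V" using V(2) X(3) by blast
      ultimately show ?thesis using f M(2) by (simp add: emeasure_distr)
    qed
    finally show "measure M (X \<inter> U) \<le> measure (distr M M f) (X \<inter> U)"
      by (simp add: M.emeasure_eq_measure finite_measure.emeasure_eq_measure
          prob_space.finite_measure[OF M.prob_space_distr[OF f]])
  qed (simp add: M(3))
  then have "emeasure M (f -` A \<inter> X) = emeasure M A" if "A \<in> sets M" for A
    using emeasure_distr[OF f that] M(2) by simp
  then show ?thesis using M(1-3) unfolding invariant_prob_measure_def by blast
qed

theorem minimal_approximate_product_uniquely_ergodic:
  fixes X :: "'a::metric_space set"
  assumes min: "minimal_tds X f" and app: "approximate_product_property X f"
  shows "uniquely_ergodic X f"
proof -
  have tds: "tds X f" by (rule minimal_tds_tds[OF min])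
  then have X: "closed X" by (simp add: tds_def compact_imp_closed)
  note lim = birkhoff_averages_uniform_limit[OF min app]
  have "M = N" if M: "invariant_prob_measure X f M" and N: "invariant_prob_measure X f N" for M N
  proof (rule measure_eqI_continuous_integral[OF X])
    fix \<phi> :: "'a \<Rightarrow> real" assume \<phi>: "continuous_on X \<phi>"
    obtain c where c: "uniform_limit X (\<lambda>n x. birkhoff_sum f \<phi> n x / real n) (\<lambda>_. c) sequentially"
      using lim[OF \<phi>] by blast
    show "integral\<^sup>L M \<phi> = integral\<^sup>L N \<phi>"
      using invariant_integral_eq_uniform_limit[OF tds M \<phi> c]
        invariant_integral_eq_uniform_limit[OF tds N \<phi> c] by (rule trans[OF _ sym])
  qed (use M N in \<open>simp_all add: invariant_prob_measure_def\<close>)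
  moreover obtain M where "invariant_prob_measure X f M"
    using uniform_birkhoff_limits_invariant_measure_exists[OF tds lim] by blast
  ultimately show ?thesis unfolding uniquely_ergodic_def by blast
qed

subsection \<open>Entropy\<close>

text \<open>Give a word the weight \<open>s\<close> to the number of its letters other than \<open>None\<close>: the total weight
  is \<open>(1 + s |C|)\<^sup>n\<close>, and every word that is counted weighs at least \<open>s\<close> to the \<open>d\<close>.\<close>

lemma card_sparse_words:
  fixes C :: "'b set" and d s :: real and n :: nat
  assumes C: "finite C" and s: "0 < s" "s \<le> 1"
  defines "S \<equiv> {w \<in> PiE {..<n} (\<lambda>_. insert None (Some ` C)). real (card {i\<in>{..<n}. w i \<noteq> None}) \<le> d}"
  shows "finite S" "real (card S) \<le> (1 + s * real (card C)) ^ n * s powr (- d)"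
proof -
  let ?P = "PiE {..<n} (\<lambda>_. insert None (Some ` C))"
  have fin: "finite ?P" using C by (intro finite_PiE) auto
  then show finS: "finite S" unfolding S_def by simp
  define wt :: "'b option \<Rightarrow> real" where "wt v = (if v = None then 1 else s)" for v
  have wt_nonneg: "0 \<le> wt v" for v using s by (simp add: wt_def)
  have "real (card S) * s powr d = (\<Sum>w\<in>S. s powr d)" by simp
  also have "\<dots> \<le> (\<Sum>w\<in>S. \<Prod>i<n. wt (w i))"
  proof (rule sum_mono)
    fix w assume w: "w \<in> S"
    have "(\<Prod>i<n. wt (w i)) = s ^ card {i\<in>{..<n}. w i \<noteq> None}"
    proof -
      have "(\<Prod>i<n. wt (w i)) = (\<Prod>i\<in>{i\<in>{..<n}. w i \<noteq> None}. wt (w i))"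
        by (rule prod.mono_neutral_right) (auto simp: wt_def)
      also have "\<dots> = (\<Prod>i\<in>{i\<in>{..<n}. w i \<noteq> None}. s)" by (rule prod.cong) (auto simp: wt_def)
      finally show ?thesis by simp
    qed
    also have "\<dots> = s powr (real (card {i\<in>{..<n}. w i \<noteq> None}))" using s by (simp add: powr_realpow)
    finally show "s powr d \<le> (\<Prod>i<n. wt (w i))"
      using w s by (simp add: S_def powr_mono')
  qed
  also have "\<dots> \<le> (\<Sum>w\<in>?P. \<Prod>i<n. wt (w i))"
    by (intro sum_mono2 fin prod_nonneg wt_nonneg) (simp add: S_def)
  also have "\<dots> = (\<Prod>i<n. \<Sum>v\<in>insert None (Some ` C). wt v)"
    using C by (intro prod_sum_PiE[symmetric]) auto
  also have "(\<Sum>v\<in>insert None (Some ` C). wt v) = 1 + s * real (card C)"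
  proof -
    have "(\<Sum>v\<in>Some ` C. wt v) = (\<Sum>c\<in>C. s)"
      by (subst sum.reindex) (simp_all add: wt_def)
    moreover have "None \<notin> Some ` C" by blast
    ultimately show ?thesis using C by (simp add: wt_def)
  qed
  finally have "real (card S) * s powr d \<le> (1 + s * real (card C)) ^ n" by simp
  then have "real (card S) * s powr d * s powr (- d) \<le> (1 + s * real (card C)) ^ n * s powr (- d)"
    by (rule mult_right_mono) simp
  then show "real (card S) \<le> (1 + s * real (card C)) ^ n * s powr (- d)"
    using s by (simp add: mult.assoc flip: powr_add)
qed

text \<open>The left side is the logarithm of the number of pairs of numbers below
  \<open>2 * n\<close>, the cost of recording \<open>u\<close> and \<open>g\<close>.\<close>

lemma eventually_ln_double_le:
  fixes \<eta> :: real
  assumes "\<eta> > 0"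
  shows "\<forall>\<^sub>F n in sequentially. 2 * ln (2 * real n) \<le> \<eta> * real n"
proof -
  have "(\<lambda>n. 2 * (ln 2 / real n) + 2 * (ln (real n) / real n)) \<longlonglongrightarrow> 2 * 0 + 2 * 0"
    by (intro tendsto_intros lim_ln_over_n lim_const_over_n)
  then have "\<forall>\<^sub>F n in sequentially. 2 * (ln 2 / real n) + 2 * (ln (real n) / real n) < \<eta>"
    using order_tendstoD(2) assms by fastforce
  then show ?thesis
    using eventually_gt_at_top[of 0]
  proof eventually_elim
    case (elim n)
    have "2 * ln (2 * real n) = (2 * (ln 2 / real n) + 2 * (ln (real n) / real n)) * real n"
      using elim(2) by (simp add: ln_mult distrib_right)
    also have "\<dots> \<le> \<eta> * real n" using elim(1) by (intro mult_right_mono) auto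
    finally show ?case .
  qed
qed

text \<open>One good length \<open>n\<close> for each \<open>\<eta>\<close> is enough, since longer
  orbits can be cut into blocks of this length and coded block by block.\<close>

lemma minimal_approximate_product_code:
  fixes X :: "'a::metric_space set"
  assumes min: "minimal_tds X f" and app: "approximate_product_property X f"
    and "\<epsilon> > 0" "\<eta> > 0"
  shows "\<exists>n>0. \<exists>\<Phi> :: 'a \<Rightarrow> nat \<times> nat \<times> (nat \<Rightarrow> 'a option). finite (\<Phi> ` X) \<and>
      ln (real (card (\<Phi> ` X))) \<le> \<eta> * real n \<and>
      (\<forall>y\<in>X. \<forall>y'\<in>X. \<Phi> y = \<Phi> y' \<longrightarrow> (\<forall>i<n. dist ((f ^^ i) y) ((f ^^ i) y') \<le> 2 * \<epsilon>))"
proof -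
  have tds: "tds X f" by (rule minimal_tds_tds[OF min])
  then have X: "compact X" by (simp add: tds_def)
  obtain x where x: "x \<in> X" using tds by (auto simp: tds_def)
  obtain C where C: "finite C" "X \<subseteq> (\<Union>c\<in>C. ball c \<epsilon>)"
  proof (rule compactE_image[OF X])
    show "X \<subseteq> (\<Union>c\<in>X. ball c \<epsilon>)" using assms(3) by auto
  qed auto
  then obtain r where r: "\<And>y. y \<in> X \<Longrightarrow> r y \<in> C \<and> dist (r y) y < \<epsilon>"
    by (metis (no_types, lifting) UN_E mem_ball subsetD)
  define K where "K = real (card C)"
  \<comment> \<open>The logarithm of the number of codes has three parts, each allowed
    \<open>\<eta> / 3 * real n\<close>. The choice of \<open>s\<close> bounds the weights through
    \<open>ln (1 + s * K) \<le> s * K\<close>; then \<open>\<delta>\<close> controls the factor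
    \<open>s powr (- (\<delta> * real n))\<close>, and finally a large \<open>n\<close> absorbs the
    pairs \<open>(u, g)\<close>.\<close>
  define s where "s = min 1 (\<eta> / (3 * (K + 1)))"
  have K: "K \<ge> 0" by (simp add: K_def)
  have s: "0 < s" "s \<le> 1" "s * K \<le> \<eta> / 3"
  proof -
    show "0 < s" using K assms(4) by (simp add: s_def)
    have "s * K \<le> \<eta> / (3 * (K + 1)) * (K + 1)"
      using K assms(4) by (intro mult_mono) (auto simp: s_def)
    also have "\<dots> = \<eta> / 3" using K by (simp add: field_simps)
    finally show "s * K \<le> \<eta> / 3" .
  qed (simp add: s_def)
  have lns: "- ln s \<ge> 0" using s by simp
  \<comment> \<open>The denominator has \<open>1 - ln s\<close> in place of \<open>- ln s\<close>
    because \<open>s\<close> may equal 1.\<close>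
  define \<delta> where "\<delta> = \<eta> / (3 * (1 - ln s))"
  have \<delta>: "\<delta> > 0" "\<delta> * (- ln s) \<le> \<eta> / 3"
  proof -
    show "\<delta> > 0" using lns assms(4) by (simp add: \<delta>_def)
    then have "\<delta> * (- ln s) \<le> \<delta> * (1 - ln s)" by (intro mult_left_mono) auto
    also have "\<dots> = \<eta> / 3" using lns by (simp add: \<delta>_def field_simps)
    finally show "\<delta> * (- ln s) \<le> \<eta> / 3" .
  qed
  obtain M where M: "\<forall>n>M. \<forall>x\<in>X. \<forall>y\<in>X. \<exists>u g. u < g \<and> n \<le> g \<and> g < 2 * n \<and>
           real (card (faults f \<epsilon> n x u g y)) \<le> \<delta> * real n"
    using minimal_approximate_product_faults[OF min app \<delta>(1) assms(3)] by blast
  have "\<forall>\<^sub>F n in sequentially. n > M \<and> 2 * ln (2 * real n) \<le> \<eta> / 3 * real n"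
    using assms(4) by (intro eventually_conj eventually_gt_at_top eventually_ln_double_le) simp
  then obtain n where n: "n > M" "2 * ln (2 * real n) \<le> \<eta> / 3 * real n"
    by (auto simp: eventually_sequentially)
  then have n0: "n > 0" by simp
  have "\<forall>y\<in>X. \<exists>u g. u < g \<and> n \<le> g \<and> g < 2 * n \<and>
           real (card (faults f \<epsilon> n x u g y)) \<le> \<delta> * real n"
    using M n(1) x by blast
  then obtain u g where ug: "\<And>y. y \<in> X \<Longrightarrow> u y < g y \<and> g y < 2 * n \<and>
           real (card (faults f \<epsilon> n x (u y) (g y) y)) \<le> \<delta> * real n"
    by metis
  define F where "F y = faults f \<epsilon> n x (u y) (g y) y" for y
  \<comment> \<open>\<open>None\<close> marks the positions without fault, so equal words have equal
    fault sets. At those positions \<open>u\<close>, \<open>g\<close> and the fixed \<open>x\<close>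
    already determine the orbit point up to \<open>\<epsilon>\<close>.\<close>
  define w where "w y = (\<lambda>i\<in>{..<n}. if i \<in> F y then Some (r ((f ^^ i) y)) else None)" for y
  define \<Phi> where "\<Phi> y = (u y, g y, w y)" for y
  define S where "S = {w \<in> PiE {..<n} (\<lambda>_. insert None (Some ` C)).
      real (card {i\<in>{..<n}. w i \<noteq> None}) \<le> \<delta> * real n}"
  have S: "finite S" "real (card S) \<le> (1 + s * K) ^ n * s powr (- (\<delta> * real n))"
    unfolding S_def K_def using card_sparse_words[OF C(1) s(1,2)] by blast+
  have sub: "\<Phi> ` X \<subseteq> {..<2*n} \<times> {..<2*n} \<times> S"
  proof
    fix z assume "z \<in> \<Phi> ` X"
    then obtain y where y: "y \<in> X" "z = \<Phi> y" by blast
    have "{i\<in>{..<n}. w y i \<noteq> None} = F y"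
      by (auto simp: w_def F_def faults_def)
    moreover have "w y \<in> PiE {..<n} (\<lambda>_. insert None (Some ` C))"
      using r[OF funpow_in[OF tds y(1)]] by (auto simp: w_def)
    ultimately have "w y \<in> S" using ug[OF y(1)] by (simp add: S_def F_def)
    then show "z \<in> {..<2*n} \<times> {..<2*n} \<times> S" using ug[OF y(1)] y(2) by (auto simp: \<Phi>_def)
  qed
  have fin: "finite (\<Phi> ` X)" using sub by (rule finite_subset) (simp add: S(1))
  have "real (card (\<Phi> ` X)) \<le> real (card ({..<2*n} \<times> {..<2*n} \<times> S))"
    using S(1) by (intro of_nat_mono card_mono sub) simp
  also have "\<dots> = (2 * real n)\<^sup>2 * real (card S)"
    by (simp add: power2_eq_square card_cartesian_product)
  also have "\<dots> \<le> (2 * real n)\<^sup>2 * ((1 + s * K) ^ n * s powr (- (\<delta> * real n)))"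
    using S(2) by (intro mult_left_mono) auto
  finally have card: "real (card (\<Phi> ` X)) \<le> (2 * real n)\<^sup>2 * ((1 + s * K) ^ n * s powr (- (\<delta> * real n)))" .
  have "\<Phi> ` X \<noteq> {}" using x by blast
  then have pos: "real (card (\<Phi> ` X)) > 0" using fin by (simp add: card_gt_0_iff)
  have sK: "1 + s * K > 0" using s(1) K by (simp add: add_pos_nonneg)
  have "ln (real (card (\<Phi> ` X))) \<le> ln ((2 * real n)\<^sup>2 * ((1 + s * K) ^ n * s powr (- (\<delta> * real n))))"
    by (rule ln_mono[OF card pos])
  also have "\<dots> = 2 * ln (2 * real n) + (real n * ln (1 + s * K) + real n * (\<delta> * (- ln s)))"
  proof -
    have ln: "ln (p\<^sup>2 * (a ^ n * b)) = 2 * ln p + (real n * ln a + ln b)"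
      if "p > 0" "a > 0" "b > 0" for p a b :: real
      using that by (simp add: ln_mult ln_realpow)
    show ?thesis using n0 sK s(1) by (subst ln) (simp_all add: ln_powr)
  qed
  also have "\<dots> \<le> \<eta> / 3 * real n + (real n * (\<eta> / 3) + real n * (\<eta> / 3))"
    using n(2) \<delta>(2) ln_add_one_self_le_self[of "s * K"] s K
    by (intro add_mono mult_left_mono) (auto intro: order_trans)
  also have "\<dots> = \<eta> * real n" by simp
  finally have ln_le: "ln (real (card (\<Phi> ` X))) \<le> \<eta> * real n" .
  have "dist ((f ^^ i) y) ((f ^^ i) y') \<le> 2 * \<epsilon>"
    if y: "y \<in> X" "y' \<in> X" "\<Phi> y = \<Phi> y'" and i: "i < n" for y y' i
  proof -
    have eq: "u y = u y'" "g y = g y'" "w y i = w y' i" using y(3) by (simp_all add: \<Phi>_def)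
    show ?thesis
    proof (cases "i \<in> F y")
      case True
      then have "i \<in> F y'" "r ((f ^^ i) y) = r ((f ^^ i) y')"
        using eq(3) i by (auto simp: w_def split: if_splits)
      then show ?thesis
        using r[OF funpow_in[OF tds y(1), of i]] r[OF funpow_in[OF tds y(2), of i]]
          dist_triangle3[of "(f ^^ i) y" "(f ^^ i) y'" "r ((f ^^ i) y)"] by simp
    next
      case False
      then have "i \<notin> F y'" using eq(3) i by (auto simp: w_def split: if_splits)
      let ?p = "(f ^^ phase (u y) (g y) i) x"
      have "dist ((f ^^ i) y) ?p \<le> \<epsilon>" "dist ((f ^^ i) y') ?p \<le> \<epsilon>"
        using False \<open>i \<notin> F y'\<close> i eq(1,2) by (auto simp: F_def faults_def)
      then show ?thesis using dist_triangle2[of "(f ^^ i) y" "(f ^^ i) y'" ?p] by simp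
    qed
  qed
  then show ?thesis using n0 fin ln_le by blast
qed

text \<open>Points whose successive blocks of length \<open>n\<close> have equal codes stay within
  \<open>\<epsilon>\<close> up to time \<open>N\<close>, so separated points have distinct code
  sequences. The \<open>Suc\<close> accounts for a last, incomplete block.\<close>

lemma max_separated_le_code_power:
  fixes \<Phi> :: "'a::metric_space \<Rightarrow> 'b"
  assumes tds: "tds X f" and n: "n > 0" and "\<epsilon> > 0" and fin: "finite (\<Phi> ` X)"
    and code: "\<And>y y' i. y \<in> X \<Longrightarrow> y' \<in> X \<Longrightarrow> \<Phi> y = \<Phi> y' \<Longrightarrow> i < n \<Longrightarrow>
      dist ((f ^^ i) y) ((f ^^ i) y') \<le> \<epsilon>"
  shows "max_separated X f N \<epsilon> \<le> card (\<Phi> ` X) ^ Suc (N div n)"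
  unfolding max_separated_def
proof (rule Max.boundedI)
  show "finite {card E |E. finite E \<and> E \<subseteq> X \<and> separated f N \<epsilon> E}"
    by (rule separated_card_finite[OF tds assms(3)])
  have "card {} \<in> {card E |E. finite E \<and> E \<subseteq> X \<and> separated f N \<epsilon> E}"
    by (intro CollectI exI[of _ "{}"]) (simp add: separated_def)
  then show "{card E |E. finite E \<and> E \<subseteq> X \<and> separated f N \<epsilon> E} \<noteq> {}" by blast
  fix a assume "a \<in> {card E |E. finite E \<and> E \<subseteq> X \<and> separated f N \<epsilon> E}"
  then obtain E where E: "a = card E" "E \<subseteq> X" "separated f N \<epsilon> E" by blast
  define \<Psi> where "\<Psi> y = (\<lambda>l\<in>{..N div n}. \<Phi> ((f ^^ (n * l)) y))" for y
  have "inj_on \<Psi> E"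
  proof (rule inj_onI, rule ccontr)
    fix y y' assume y: "y \<in> E" "y' \<in> E" "\<Psi> y = \<Psi> y'" "y \<noteq> y'"
    then obtain k where k: "k < N" "dist ((f ^^ k) y) ((f ^^ k) y') > \<epsilon>"
      using E(3) unfolding separated_def by blast
    define l where "l = k div n"
    have "l \<le> N div n" using k(1) by (simp add: l_def div_le_mono)
    then have "\<Phi> ((f ^^ (n * l)) y) = \<Phi> ((f ^^ (n * l)) y')"
      using fun_cong[OF y(3), of l] by (simp add: \<Psi>_def)
    then have "dist ((f ^^ (k mod n)) ((f ^^ (n * l)) y)) ((f ^^ (k mod n)) ((f ^^ (n * l)) y')) \<le> \<epsilon>"
      using y(1,2) E(2) n funpow_in[OF tds] by (intro code) auto
    moreover have "(f ^^ (k mod n)) ((f ^^ (n * l)) z) = (f ^^ k) z" for z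
    proof -
      have "(f ^^ k) z = (f ^^ (k mod n + n * l)) z" by (simp add: l_def)
      then show ?thesis by (simp only: funpow_add comp_apply)
    qed
    ultimately show False using k(2) by simp
  qed
  moreover have "\<Psi> ` E \<subseteq> PiE {..N div n} (\<lambda>_. \<Phi> ` X)"
    using E(2) funpow_in[OF tds] by (auto simp: \<Psi>_def split: if_splits)
  ultimately have "card E \<le> card (PiE {..N div n} (\<lambda>_. \<Phi> ` X))"
    using fin by (intro card_inj_on_le[of \<Psi>]) (auto intro: finite_PiE)
  then show "a \<le> card (\<Phi> ` X) ^ Suc (N div n)" by (simp add: E(1) card_PiE)
qed

theorem minimal_approximate_product_entropy_zero:
  fixes X :: "'a::metric_space set"
  assumes min: "minimal_tds X f" and app: "approximate_product_property X f"
  shows "top_entropy X f = 0"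
proof -
  have tds: "tds X f" by (rule minimal_tds_tds[OF min])
  have le: "entropy_at_scale X f \<epsilon> \<le> ereal \<eta>" if \<epsilon>: "\<epsilon> > 0" and \<eta>: "\<eta> > 0" for \<epsilon> \<eta>
  proof -
    \<comment> \<open>Half of \<open>\<eta>\<close>, because rounding up to whole blocks at most
      doubles the length once \<open>N \<ge> n\<close>; half of \<open>\<epsilon>\<close>, because a
      code determines points only up to twice its scale.\<close>
    obtain n \<Phi> where n: "n > 0"
      and \<Phi>: "finite (\<Phi> ` X)" "ln (real (card (\<Phi> ` X))) \<le> \<eta>/2 * real n"
      "\<And>y y' i. y \<in> X \<Longrightarrow> y' \<in> X \<Longrightarrow> \<Phi> y = (\<Phi> y' :: nat \<times> nat \<times> (nat \<Rightarrow> 'a option)) \<Longrightarrow> i < n \<Longrightarrow>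
        dist ((f ^^ i) y) ((f ^^ i) y') \<le> 2 * (\<epsilon>/2)"
      using minimal_approximate_product_code[OF min app half_gt_zero[OF \<epsilon>] half_gt_zero[OF \<eta>]]
      by blast
    let ?W = "card (\<Phi> ` X)"
    have "ln (real (max_separated X f N \<epsilon>)) / real N \<le> \<eta>" if N: "N \<ge> n" for N
    proof -
      have "max_separated X f N \<epsilon> \<le> ?W ^ Suc (N div n)"
        using \<Phi>(3) by (intro max_separated_le_code_power[OF tds n \<open>\<epsilon> > 0\<close> \<Phi>(1)]) simp
      moreover have "1 \<le> max_separated X f N \<epsilon>"
        by (rule max_separated_pos[OF tds \<open>\<epsilon> > 0\<close>])
      ultimately have "ln (real (max_separated X f N \<epsilon>)) \<le> ln (real (?W ^ Suc (N div n)))"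
        by (intro ln_mono of_nat_mono) simp_all
      also have "\<dots> = real (Suc (N div n)) * ln (real ?W)"
        unfolding of_nat_power by (rule ln_realpow)
      also have "\<dots> \<le> real (Suc (N div n)) * (\<eta>/2 * real n)"
        using \<Phi>(2) by (intro mult_left_mono) auto
      also have "\<dots> = \<eta>/2 * real (Suc (N div n) * n)" by (simp add: algebra_simps)
      also have "\<dots> \<le> \<eta>/2 * real (2 * N)"
      proof -
        have "Suc (N div n) * n \<le> 2 * N"
          using N div_times_less_eq_dividend[of N n] unfolding mult_Suc by linarith
        then show ?thesis using \<open>\<eta> > 0\<close> by (intro mult_left_mono of_nat_mono) auto
      qed
      finally show ?thesis using N n by (simp add: field_simps)
    qed
    then show ?thesis
      unfolding entropy_at_scale_def
      by (intro Limsup_bounded) (auto simp: eventually_sequentially intro!: exI[of _ n])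
  qed
  \<comment> \<open>A single scale suffices for the lower bound, the entropy being a supremum over
    scales.\<close>
  have ge: "0 \<le> entropy_at_scale X f 1"
  proof -
    have "0 \<le> ln (real (max_separated X f N 1)) / real N" for N
      using max_separated_pos[OF tds, of 1 N] by simp
    then show ?thesis
      unfolding entropy_at_scale_def
      by (intro le_Limsup) (auto intro!: always_eventually simp: zero_ereal_def)
  qed
  have "entropy_at_scale X f \<epsilon> \<le> 0" if "\<epsilon> > 0" for \<epsilon>
    by (rule ereal_le_epsilon2) (use le[OF that] in auto)
  then have "(SUP \<epsilon>\<in>{0<..}. entropy_at_scale X f \<epsilon>) \<le> 0" by (intro SUP_least) simp
  moreover have "0 \<le> (SUP \<epsilon>\<in>{0<..}. entropy_at_scale X f \<epsilon>)"
    using ge by (rule order_trans) (auto intro: SUP_upper)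
  ultimately show ?thesis unfolding top_entropy_eq_SUP[OF tds] by (rule antisym)
qed

theorem corollary1p6:
  fixes X :: "'a::metric_space set" and f :: "'a \<Rightarrow> 'a"
  assumes "minimal_tds X f"
    and "approximate_product_property X f"
  shows "uniquely_ergodic X f \<and> top_entropy X f = 0"
  using minimal_approximate_product_uniquely_ergodic[OF assms]
    minimal_approximate_product_entropy_zero[OF assms] by blast

end
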